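(* There exists a function $\varepsilon:\mathbb{Z}_{\ge 1}\to[0,\infty)$ with $\varepsilon(k)\to 0$ as $k\to\infty$ such that for every integer $k\ge 1$ and every finite nonempty set $X\subseteq[0,1]^k$ there exists a Hamiltonian cycle $H$ on $X$ such that, if $e_1,e_2\in H$ are two longest edges of $H$, then $$\sum_{e\in H\setminus\{e_1,e_2\}}|e|^k\le \varepsilon(k)\cdot k^{k/2},\qquad\text{so}\qquad S_k(H)=\sum_{e\in H}|e|^k\le k^{k/2}\cdot(2+\varepsilon(k)).$$ In particular, $S_k^{\mathrm{HC}}=k^{k/2}\cdot(2+o_k(1))$, i.e. $S_k^{\mathrm{HC}}/k^{k/2}\to 2$ as $k\to\infty$.
   Context: $|\cdot|$ is the Euclidean norm on $\mathbb{R}^k$; for an edge $e=\mathbf{a}\mathbf{b}$ with $\mathbf{a},\mathbf{b}\in\mathbb{R}^k$, $|e|:=|\mathbf{a}-\mathbf{b}|$. A Hamiltonian cycle $H$ on a finite nonempty set $X$ with $|X|=n$ is a Hamiltonian cycle in the complete graph on $X$, i.e. a closed tour given by an ordering $\mathbf{x}_1,\dots,\mathbf{x}_n$ of $X$ with edges $\mathbf{x}_i\mathbf{x}_{i+1}$, $1\le i\le n$, $\mathbf{x}_{n+1}=\mathbf{x}_1$. Edges are counted with multiplicity: for $n=2$ the cycle consists of the same edge taken twice; for $n=1$ it is a single degenerate edge of length $0$ (when there are at most two edges, the sum over $H\setminus\{e_1,e_2\}$ is empty). For an integer $t\ge1$, $S_t(H):=\sum_{e\in H}|e|^t$. Set $S_k^{\mathrm{HC}}(X):=\min_H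 S_k(H)$ over all Hamiltonian cycles $H$ on $X$, and $S_k^{\mathrm{HC}}:=\sup\{S_k^{\mathrm{HC}}(X): X\subseteq[0,1]^k \text{ finite}\}$. *)

theory Defs
  imports "HOL-Analysis.Analysis"
begin

text \<open>The dimension \<open>k\<close> varies inside the statement, so a point of \<open>\<real>\<^sup>k\<close> is a function
  on \<open>{..<k}\<close>, made extensional (\<open>undefined\<close> elsewhere) so that distinct functions are distinct
  points.\<close>

type_synonym point = "nat \<Rightarrow> real"

definition unit_cube :: "nat \<Rightarrow> point set" where
  "unit_cube k = {..<k} \<rightarrow>\<^sub>E {0..1}"

definition euclid_dist :: "nat \<Rightarrow> point \<Rightarrow> point \<Rightarrow> real" where
  "euclid_dist k a b = L2_set (\<lambda>i. a i - b i) {..<k}"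

text \<open>A Hamiltonian cycle on \<open>X\<close> is given by an ordering \<open>xs\<close> of \<open>X\<close>. Its edges are represented
  by the indices \<open>i < length xs\<close>, edge \<open>i\<close> joining \<open>xs ! i\<close> to its cyclic successor, so that
  edges are counted with multiplicity: two points give the same edge twice, and a single point
  gives one degenerate edge.\<close>

definition hamiltonian_cycle :: "point set \<Rightarrow> point list \<Rightarrow> bool" where
  "hamiltonian_cycle X xs \<longleftrightarrow> distinct xs \<and> set xs = X"

definition edge_length :: "nat \<Rightarrow> point list \<Rightarrow> nat \<Rightarrow> real" where
  "edge_length k xs i = euclid_dist k (xs ! i) (xs ! (Suc i mod length xs))"

definition cycle_sum :: "nat \<Rightarrow> nat \<Rightarrow> point list \<Rightarrow> real" where
  "cycle_sum k t xs = (\<Sum>i<length xs. edge_length k xs i ^ t)"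

text \<open>A cycle with a single edge has no two distinct edges; then \<open>e1 = e2\<close> is that edge, and no
  edge remains after its removal.\<close>

definition two_longest_edges :: "nat \<Rightarrow> point list \<Rightarrow> nat \<Rightarrow> nat \<Rightarrow> bool" where
  "two_longest_edges k xs e1 e2 \<longleftrightarrow>
     e1 < length xs \<and> e2 < length xs \<and> (length xs \<ge> 2 \<longrightarrow> e1 \<noteq> e2) \<and>
     (\<forall>e \<in> {..<length xs} - {e1, e2}.
        edge_length k xs e \<le> edge_length k xs e1 \<and> edge_length k xs e \<le> edge_length k xs e2)"

definition min_cycle_sum :: "nat \<Rightarrow> point set \<Rightarrow> real" where
  "min_cycle_sum k X = Min (cycle_sum k k ` {xs. hamiltonian_cycle X xs})"

text \<open>The supremum is taken in \<^typ>\<open>ereal\<close>, so that it is meaningful without first knowing that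
  the values are bounded.\<close>

definition sup_min_cycle_sum :: "nat \<Rightarrow> ereal" where
  "sup_min_cycle_sum k =
     (SUP X \<in> {X. finite X \<and> X \<noteq> {} \<and> X \<subseteq> unit_cube k}. ereal (min_cycle_sum k X))"

end

theory Submission
  imports Defs "HOL-Library.Multiset" "HOL-Real_Asymp.Real_Asymp"
begin

text \<open>Let \<open>D = 1 / k\<close> and choose an ordering of \<open>X\<close> minimising the sum of
  \<open>min (|e|) D ^ T\<close> over the edges of the path, \<open>T\<close> being a large constant. By 2-optimality, any two
  oriented edges \<open>ab\<close>, \<open>ce\<close> of length at most \<open>D\<close> satisfy \<open>|a - c|^2 + |b - e|^2 \<ge> 0.999 |a - b|^2\<close>.
  Hence, among the edges making an angle of at most about 45 degrees with a fixed direction, the balls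
  of radius \<open>0.35 |e|\<close> around the midpoints have bounded overlap. Averaging over the direction and
  comparing volumes bounds the sum over these short edges by \<open>k powr (k / 2)\<close> times a factor of order
  \<open>k * (0.35 * 0.7 * sqrt (2 * pi * exp 1)) ^ (-k)\<close>, which tends to 0.

  The edges of length at least \<open>D\<close> are removed. Again by 2-optimality, the heads of the resulting
  paths are \<open>D\<close>-separated, so there are at most \<open>k ^ O(k)\<close> paths. Joining the two closest heads while
  \<open>j \<ge> 3\<close> paths remain costs at most \<open>k powr (k / 2) * 1500 * 0.845 ^ k / j\<close>, because \<open>j\<close> points of
  the cube at mutual distance \<open>d \<le> sqrt (2 * k / 3)\<close> satisfy a volume bound; the harmonic sum only
  contributes a factor of order \<open>k * ln k\<close>. When two paths remain, the two edges closing them to a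
  cycle have length at most \<open>sqrt k\<close>.\<close>

section \<open>Distances and volumes in the cube\<close>

definition sqdist :: "nat \<Rightarrow> point \<Rightarrow> point \<Rightarrow> real" where
  "sqdist k x y = (\<Sum>i<k. (x i - y i)\<^sup>2)"

abbreviation leb :: "nat \<Rightarrow> point measure" where
  "leb k \<equiv> Pi\<^sub>M {..<k} (\<lambda>_. lborel)"

lemma sqdist_nonneg [simp]: "0 \<le> sqdist k x y"
  by (simp add: sqdist_def sum_nonneg)

lemma euclid_dist_altdef: "euclid_dist k x y = sqrt (sqdist k x y)"
  by (simp add: euclid_dist_def sqdist_def L2_set_def)

lemma euclid_dist_nonneg [simp]: "0 \<le> euclid_dist k x y"
  by (simp add: euclid_dist_altdef)

lemma euclid_dist_power2: "(euclid_dist k x y)\<^sup>2 = sqdist k x y"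
  by (simp add: euclid_dist_altdef)

lemma sqdist_commute: "sqdist k x y = sqdist k y x"
  by (simp add: sqdist_def power2_commute)

lemma euclid_dist_commute: "euclid_dist k x y = euclid_dist k y x"
  by (simp add: euclid_dist_altdef sqdist_commute)

lemma unit_cubeD: "x \<in> unit_cube k \<Longrightarrow> i < k \<Longrightarrow> 0 \<le> x i \<and> x i \<le> 1"
  by (auto simp: unit_cube_def PiE_iff)

section \<open>Packing bounds for separated families of vectors\<close>

lemma sum_square_differences:
  fixes f :: "'a \<Rightarrow> real"
  shows "(\<Sum>i\<in>J. \<Sum>j\<in>J. (f i - f j)\<^sup>2) = 2 * card J * (\<Sum>i\<in>J. (f i)\<^sup>2) - 2 * (\<Sum>i\<in>J. f i)\<^sup>2"
proof -
  have "(\<Sum>i\<in>J. \<Sum>j\<in>J. (f i - f j)\<^sup>2) = (\<Sum>i\<in>J. \<Sum>j\<in>J. ((f i)\<^sup>2 + (f j)\<^sup>2) - 2 * (f i * f j))"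
    by (simp add: power2_diff mult.assoc)
  also have "\<dots> = (\<Sum>i\<in>J. \<Sum>j\<in>J. (f i)\<^sup>2) + (\<Sum>i\<in>J. \<Sum>j\<in>J. (f j)\<^sup>2) - 2 * (\<Sum>i\<in>J. \<Sum>j\<in>J. f i * f j)"
    by (simp only: sum.distrib sum_subtractf sum_distrib_left)
  also have "(\<Sum>i\<in>J. \<Sum>j\<in>J. (f i)\<^sup>2) = card J * (\<Sum>i\<in>J. (f i)\<^sup>2)"
    by (simp add: sum_distrib_left)
  finally show ?thesis
    by (simp add: sum_product power2_eq_square)
qed

text \<open>Over ordered pairs, the squared distances add up to at least card J * (card J - 1) *
  \<alpha>. By the preceding identity they add up to at most 2 * (card J)^2 * \<beta>, after the
  square of the total is dropped. This limits the size of \<open>J\<close> as soon as 2 * \<beta> <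
  \<alpha>, which is how the packing estimates below fix their constants.\<close>

lemma separated_card_le:
  fixes f :: "'a \<Rightarrow> 'b \<Rightarrow> real" and \<alpha> \<beta> :: real
  assumes fin: "finite J"
    and bnd: "\<And>i. i \<in> J \<Longrightarrow> (\<Sum>n\<in>S. (f i n)\<^sup>2) \<le> \<beta>"
    and sep: "\<And>i j. i \<in> J \<Longrightarrow> j \<in> J \<Longrightarrow> i \<noteq> j \<Longrightarrow> \<alpha> \<le> (\<Sum>n\<in>S. (f i n - f j n)\<^sup>2)"
  shows "(real (card J) - 1) * \<alpha> \<le> 2 * card J * \<beta> \<or> J = {}"
proof (cases "J = {}")
  case False
  have "card J * ((real (card J) - 1) * \<alpha>) = (\<Sum>i\<in>J. \<Sum>j\<in>J-{i}. \<alpha>)"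
  proof -
    have "(\<Sum>j\<in>J-{i}. \<alpha>) = (real (card J) - 1) * \<alpha>" if "i \<in> J" for i
    proof -
      have "card J = Suc (card (J - {i}))" using that fin by (rule card.remove[rotated])
      then have "real (card (J - {i})) = real (card J) - 1" by linarith
      then show ?thesis by (simp only: sum_constant)
    qed
    then have "(\<Sum>i\<in>J. \<Sum>j\<in>J-{i}. \<alpha>) = (\<Sum>i\<in>J. (real (card J) - 1) * \<alpha>)" by (rule sum.cong[OF refl])
    then show ?thesis by (simp only: sum_constant)
  qed
  also have "\<dots> \<le> (\<Sum>i\<in>J. \<Sum>j\<in>J-{i}. \<Sum>n\<in>S. (f i n - f j n)\<^sup>2)"
    by (intro sum_mono sep) auto
  also have "\<dots> \<le> (\<Sum>i\<in>J. \<Sum>j\<in>J. \<Sum>n\<in>S. (f i n - f j n)\<^sup>2)"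
    by (intro sum_mono sum_mono2) (auto simp: fin sum_nonneg)
  also have "\<dots> = (\<Sum>n\<in>S. \<Sum>i\<in>J. \<Sum>j\<in>J. (f i n - f j n)\<^sup>2)"
  proof -
    have "(\<Sum>j\<in>J. \<Sum>n\<in>S. (f i n - f j n)\<^sup>2) = (\<Sum>n\<in>S. \<Sum>j\<in>J. (f i n - f j n)\<^sup>2)" for i
      by (rule sum.swap)
    then show ?thesis by (simp only:) (rule sum.swap)
  qed
  also have "\<dots> \<le> (\<Sum>n\<in>S. 2 * card J * (\<Sum>i\<in>J. (f i n)\<^sup>2))"
    by (intro sum_mono) (simp add: sum_square_differences)
  also have "\<dots> = 2 * card J * (\<Sum>i\<in>J. \<Sum>n\<in>S. (f i n)\<^sup>2)"
    by (simp add: sum_distrib_left) (rule sum.swap)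
  also have "\<dots> \<le> 2 * card J * (\<Sum>i\<in>J. \<beta>)"
    by (intro mult_left_mono sum_mono bnd) auto
  also have "\<dots> = card J * (2 * card J * \<beta>)" by simp
  finally show ?thesis
    using fin False by (simp add: card_gt_0_iff)
qed simp

section \<open>Lebesgue measure of boxes and balls\<close>

lemma measurable_sqdist [measurable]: "(\<lambda>x. sqdist k x c) \<in> borel_measurable (leb k)"
  unfolding sqdist_def by measurable

lemma product_sigma_finite_lborel: "product_sigma_finite (\<lambda>_. lborel :: real measure)"
  by standard

lemma sets_Box: "(\<Pi>\<^sub>E i\<in>{..<k}. {a i..b i}) \<in> sets (leb k)"
  by (intro sets_PiM_I_finite) auto

lemma emeasure_Box:
  assumes "\<And>i. i < k \<Longrightarrow> a i \<le> b i"
  shows "emeasure (leb k) (\<Pi>\<^sub>E i\<in>{..<k}. {a i..b i}) = ennreal (\<Prod>i<k. b i - a i)"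
proof -
  interpret product_sigma_finite "\<lambda>_::nat. lborel :: real measure" by (rule product_sigma_finite_lborel)
  show ?thesis
    using assms by (simp add: emeasure_PiM) (rule prod_ennreal, simp)
qed

text \<open>The left side is the integral of the number of sets containing x; this count is at most
  \<open>K\<close> on \<open>B\<close> and zero outside.\<close>

lemma overlap_measure_le:
  assumes fin: "finite I" and A: "\<And>i. i \<in> I \<Longrightarrow> A i \<in> sets M" and B: "B \<in> sets M"
    and sub: "\<And>i. i \<in> I \<Longrightarrow> A i \<subseteq> B"
    and ov: "\<And>x. x \<in> B \<Longrightarrow> real (card {i\<in>I. x \<in> A i}) \<le> K" and K: "0 \<le> K"
  shows "(\<Sum>i\<in>I. emeasure M (A i)) \<le> ennreal K * emeasure M B"
proof -
  have "(\<Sum>i\<in>I. emeasure M (A i)) = (\<Sum>i\<in>I. \<integral>\<^sup>+x. indicator (A i) x \<partial>M)"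
    using A by simp
  also have "\<dots> = (\<integral>\<^sup>+x. (\<Sum>i\<in>I. indicator (A i) x) \<partial>M)"
    using A by (subst nn_integral_sum) auto
  also have "\<dots> \<le> (\<integral>\<^sup>+x. ennreal K * indicator B x \<partial>M)"
  proof (intro nn_integral_mono)
    fix x
    have "(\<Sum>i\<in>I. indicator (A i) x :: ennreal) = of_nat (card {i\<in>I. x \<in> A i})"
      using fin by (simp add: indicator_def sum.If_cases Int_def)
    also have "\<dots> \<le> ennreal K * indicator B x"
    proof (cases "x \<in> B")
      case True
      then show ?thesis using ov[OF True] K by (simp add: ennreal_of_nat_eq_real_of_nat ennreal_leI)
    next
      case False
      then have "{i\<in>I. x \<in> A i} = {}" using sub by auto
      then show ?thesis by (simp only: card.empty of_nat_0 zero_le)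
    qed
    finally show "(\<Sum>i\<in>I. indicator (A i) x :: ennreal) \<le> ennreal K * indicator B x" .
  qed
  also have "\<dots> = ennreal K * emeasure M B"
    using B by (simp add: nn_integral_cmult)
  finally show ?thesis .
qed

text \<open>Fubini: the integrand is a product of one-variable factors, and every factor except the
  one at \<open>j\<close> integrates to \<open>b\<close>.\<close>

lemma nn_integral_Box_coordinate:
  fixes g :: "real \<Rightarrow> ennreal"
  assumes j: "j < k" and b: "0 \<le> b" and [measurable]: "g \<in> borel_measurable borel"
  shows "(\<integral>\<^sup>+x. g (x j) * indicator (\<Pi>\<^sub>E i\<in>{..<k}. {l i..l i + b}) x \<partial>leb k)
         = ennreal (b ^ (k - 1)) * (\<integral>\<^sup>+t. g t * indicator {l j..l j + b} t \<partial>lborel)"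
proof -
  interpret product_sigma_finite "\<lambda>_::nat. lborel :: real measure" by (rule product_sigma_finite_lborel)
  define f where "f i t = (if i = j then g t else 1) * indicator {l i..l i + b} t" for i t
  have [measurable]: "f i \<in> borel_measurable borel" for i
    unfolding f_def by (cases "i = j") auto
  have "(\<integral>\<^sup>+x. g (x j) * indicator (\<Pi>\<^sub>E i\<in>{..<k}. {l i..l i + b}) x \<partial>leb k)
        = (\<integral>\<^sup>+x. (\<Prod>i<k. f i (x i)) \<partial>leb k)"
  proof (intro nn_integral_cong)
    fix x assume x: "x \<in> space (leb k)"
    have "(\<Prod>i<k. f i (x i)) = (\<Prod>i<k. if i = j then g (x i) else 1) * (\<Prod>i<k. indicator {l i..l i + b} (x i))"
      unfolding f_def by (rule prod.distrib)
    also have "(\<Prod>i<k. if i = j then g (x i) else 1) = g (x j)"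
      using j by (simp add: prod.delta)
    also have "(\<Prod>i<k. indicator {l i..l i + b} (x i) :: ennreal) = indicator (\<Pi>\<^sub>E i\<in>{..<k}. {l i..l i + b}) x"
      using x by (auto simp: indicator_def PiE_iff space_PiM prod_zero_iff)
    finally show "g (x j) * indicator (\<Pi>\<^sub>E i\<in>{..<k}. {l i..l i + b}) x = (\<Prod>i<k. f i (x i))" by simp
  qed
  also have "\<dots> = (\<Prod>i<k. \<integral>\<^sup>+t. f i t \<partial>lborel)"
    by (rule product_nn_integral_prod) auto
  also have "\<dots> = (\<integral>\<^sup>+t. f j t \<partial>lborel) * (\<Prod>i\<in>{..<k}-{j}. \<integral>\<^sup>+t. f i t \<partial>lborel)"
    using j by (subst prod.remove[of _ j]) auto
  also have "(\<Prod>i\<in>{..<k}-{j}. \<integral>\<^sup>+t. f i t \<partial>lborel) = (\<Prod>i\<in>{..<k}-{j}. ennreal b)"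
    using b by (intro prod.cong) (auto simp: f_def)
  also have "\<dots> = ennreal (b ^ (k - 1))"
    using j b by (simp add: ennreal_power)
  finally show ?thesis by (simp add: f_def mult.commute)
qed

text \<open>With p and q the distances from \<open>y\<close> to the two ends, the integral is (p^3 +
  q^3) / 3, which is largest when \<open>y\<close> is an endpoint.\<close>

lemma nn_integral_square_interval:
  assumes "0 \<le> b" "l \<le> y" "y \<le> l + b"
  shows "(\<integral>\<^sup>+t. ennreal ((t - y)\<^sup>2) * indicator {l..l + b} t \<partial>lborel) \<le> ennreal (b ^ 3 / 3)"
proof -
  have "(\<integral>\<^sup>+t. ennreal ((t - y)\<^sup>2) * indicator {l..l + b} t \<partial>lborel) = ennreal ((l + b - y) ^ 3 / 3 - (l - y) ^ 3 / 3)"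
    by (intro nn_integral_FTC_Icc[where F = "\<lambda>t. (t - y) ^ 3 / 3"])
       (use assms in \<open>auto intro!: derivative_eq_intros simp: power2_eq_square\<close>)
  also have "(l + b - y) ^ 3 / 3 - (l - y) ^ 3 / 3 \<le> b ^ 3 / 3"
  proof -
    define p q where "p = l + b - y" and "q = y - l"
    have "0 \<le> p" "0 \<le> q" "b = p + q" using assms by (auto simp: p_def q_def)
    moreover have "(l - y) ^ 3 = - (q ^ 3)" "(l + b - y) ^ 3 = p ^ 3"
      by (simp_all add: p_def q_def power3_eq_cube algebra_simps)
    moreover have "p ^ 3 + q ^ 3 \<le> (p + q) ^ 3"
      using \<open>0 \<le> p\<close> \<open>0 \<le> q\<close> by (simp add: power3_eq_cube algebra_simps)
    ultimately show ?thesis by simp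
  qed
  finally show ?thesis by (simp add: ennreal_leI)
qed

lemma distr_translation_leb:
  "distr (leb k) (leb k) (\<lambda>x. \<lambda>i\<in>{..<k}. x i + c i) = leb k"
proof -
  interpret product_sigma_finite "\<lambda>_::nat. lborel :: real measure" by (rule product_sigma_finite_lborel)
  have meas: "(\<lambda>x. \<lambda>i\<in>{..<k}. x i + c i) \<in> measurable (leb k) (leb k)" by measurable
  show ?thesis
  proof (rule PiM_eqI)
    fix A :: "nat \<Rightarrow> real set" assume A: "\<And>i. i \<in> {..<k} \<Longrightarrow> A i \<in> sets lborel"
    have shift: "(\<lambda>t. c i + t) -` A i \<in> sets borel" if "i < k" for i
      using measurable_sets_borel[of "\<lambda>t. c i + t" borel "A i"] A that by auto
    have "emeasure (distr (leb k) (leb k) (\<lambda>x. \<lambda>i\<in>{..<k}. x i + c i)) (Pi\<^sub>E {..<k} A)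
       = emeasure (leb k) ((\<lambda>x. \<lambda>i\<in>{..<k}. x i + c i) -` (Pi\<^sub>E {..<k} A) \<inter> space (leb k))"
      using A by (intro emeasure_distr meas sets_PiM_I_finite) auto
    also have "(\<lambda>x. \<lambda>i\<in>{..<k}. x i + c i) -` (Pi\<^sub>E {..<k} A) \<inter> space (leb k)
       = (\<Pi>\<^sub>E i\<in>{..<k}. (\<lambda>t. c i + t) -` A i)"
      by (auto simp: space_PiM PiE_iff add.commute)
    also have "emeasure (leb k) \<dots> = (\<Prod>i<k. emeasure lborel ((\<lambda>t. c i + t) -` A i))"
      using shift by (subst emeasure_PiM) auto
    also have "\<dots> = (\<Prod>i<k. emeasure lborel (A i))"
    proof (intro prod.cong refl)
      fix i assume "i \<in> {..<k}"
      then have "emeasure (distr lborel borel ((+) (c i))) (A i) = emeasure lborel ((\<lambda>t. c i + t) -` A i)"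
        using A by (subst emeasure_distr) auto
      then show "emeasure lborel ((\<lambda>t. c i + t) -` A i) = emeasure lborel (A i)"
        by (simp add: lborel_distr_plus)
    qed
    finally show "emeasure (distr (leb k) (leb k) (\<lambda>x. \<lambda>i\<in>{..<k}. x i + c i)) (Pi\<^sub>E {..<k} A)
       = (\<Prod>i\<in>{..<k}. emeasure lborel (A i))" .
  qed auto
qed

definition ball_in :: "nat \<Rightarrow> point \<Rightarrow> real \<Rightarrow> point set" where
  "ball_in k c r = {x \<in> space (leb k). sqdist k x c \<le> r\<^sup>2}"

lemma sets_ball_in [measurable]: "ball_in k c r \<in> sets (leb k)"
  unfolding ball_in_def by measurable

lemma emeasure_ball_in:
  assumes "r > 0"
  shows "emeasure (leb k) (ball_in k c r) = ennreal (unit_ball_vol k * r ^ k)"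
proof -
  have "emeasure (leb k) (ball_in k c r) = emeasure (distr (leb k) (leb k) (\<lambda>x. \<lambda>i\<in>{..<k}. x i + c i)) (ball_in k c r)"
    by (simp add: distr_translation_leb)
  also have "\<dots> = emeasure (leb k) ((\<lambda>x. \<lambda>i\<in>{..<k}. x i + c i) -` ball_in k c r \<inter> space (leb k))"
    by (subst emeasure_distr) auto
  also have "(\<lambda>x. \<lambda>i\<in>{..<k}. x i + c i) -` ball_in k c r \<inter> space (leb k)
     = {f. sqrt (\<Sum>i\<in>{..<k}. (f i)\<^sup>2) \<le> r} \<inter> space (leb k)"
    using assms by (auto simp: ball_in_def sqdist_def real_sqrt_le_iff' sum_nonneg space_PiM)
  also have "emeasure (leb k) \<dots> = ennreal (unit_ball_vol (real (card {..<k})) * r ^ card {..<k})"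
    using assms by (intro emeasure_cball_aux) auto
  finally show ?thesis by simp
qed

text \<open>Markov's inequality: the mean of \<open>sqdist k x y\<close> over the box is at most k *
  b^2 / 3, hence at most 29/30 of \<rho>^2, so at most 29/30 of the box lies outside the
  ball.\<close>

lemma emeasure_Box_ball_ge:
  fixes b \<rho> :: real
  assumes b: "0 < b" and y: "\<And>i. i < k \<Longrightarrow> l i \<le> y i \<and> y i \<le> l i + b" and k: "k \<ge> 1"
    and rho: "0 < \<rho>" and bk: "real k * b\<^sup>2 \<le> 29/10 * \<rho>\<^sup>2"
  shows "ennreal (b ^ k / 30) \<le> emeasure (leb k) ((\<Pi>\<^sub>E i\<in>{..<k}. {l i..l i + b}) \<inter> ball_in k y \<rho>)"
proof -
  let ?B = "\<Pi>\<^sub>E i\<in>{..<k}. {l i..l i + b}"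
  have [measurable]: "?B \<in> sets (leb k)" by (rule sets_Box)
  have sub: "?B \<subseteq> space (leb k)" by (auto simp: space_PiM)
  have muB: "emeasure (leb k) ?B = ennreal (b ^ k)"
    using b by (subst emeasure_Box) auto
  let ?E = "?B - ball_in k y \<rho>"
  have bk': "b ^ (k - 1) * (b ^ 3 / 3) * real k = b ^ k * (real k * b\<^sup>2 / 3)"
    using k by (cases k) (simp_all add: power2_eq_square power3_eq_cube)
  have "ennreal (\<rho>\<^sup>2) * emeasure (leb k) ?E = (\<integral>\<^sup>+x. ennreal (\<rho>\<^sup>2) * indicator ?E x \<partial>leb k)"
    by (subst nn_integral_cmult_indicator) auto
  also have "\<dots> \<le> (\<integral>\<^sup>+x. ennreal (sqdist k x y) * indicator ?B x \<partial>leb k)"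
    by (intro nn_integral_mono) (auto simp: indicator_def ball_in_def ennreal_leI)
  also have "\<dots> = (\<integral>\<^sup>+x. (\<Sum>j<k. ennreal ((x j - y j)\<^sup>2) * indicator ?B x) \<partial>leb k)"
    by (simp add: sqdist_def sum_distrib_right[symmetric] sum_ennreal)
  also have "\<dots> = (\<Sum>j<k. \<integral>\<^sup>+x. ennreal ((x j - y j)\<^sup>2) * indicator ?B x \<partial>leb k)"
    by (subst nn_integral_sum) auto
  also have "\<dots> \<le> (\<Sum>j<k. ennreal (b ^ (k - 1) * (b ^ 3 / 3)))"
  proof (intro sum_mono)
    fix j assume "j \<in> {..<k}" then have j: "j < k" by simp
    have "(\<integral>\<^sup>+x. ennreal ((x j - y j)\<^sup>2) * indicator ?B x \<partial>leb k)
      = ennreal (b ^ (k - 1)) * (\<integral>\<^sup>+t. ennreal ((t - y j)\<^sup>2) * indicator {l j..l j + b} t \<partial>lborel)"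
      using b j by (intro nn_integral_Box_coordinate[of j k b "\<lambda>t. ennreal ((t - y j)\<^sup>2)" l]) auto
    also have "\<dots> \<le> ennreal (b ^ (k - 1)) * ennreal (b ^ 3 / 3)"
      using b y[OF j] by (intro mult_left_mono nn_integral_square_interval) auto
    also have "\<dots> = ennreal (b ^ (k - 1) * (b ^ 3 / 3))"
      using b by (intro ennreal_mult[symmetric]) auto
    finally show "(\<integral>\<^sup>+x. ennreal ((x j - y j)\<^sup>2) * indicator ?B x \<partial>leb k) \<le> ennreal (b ^ (k - 1) * (b ^ 3 / 3))" .
  qed
  also have "\<dots> = ennreal (b ^ (k - 1) * (b ^ 3 / 3) * real k)"
    using b by (simp add: ennreal_of_nat_eq_real_of_nat ennreal_mult[symmetric] mult_ac)
  also have "\<dots> \<le> ennreal (\<rho>\<^sup>2 * (29/30 * b ^ k))"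
  proof (rule ennreal_leI)
    have "b ^ k * (real k * b\<^sup>2 / 3) \<le> b ^ k * (29/30 * \<rho>\<^sup>2)"
      using bk b by (intro mult_left_mono) auto
    then show "b ^ (k - 1) * (b ^ 3 / 3) * real k \<le> \<rho>\<^sup>2 * (29/30 * b ^ k)"
      by (simp only: bk') (simp add: mult_ac)
  qed
  finally have "ennreal (\<rho>\<^sup>2) * emeasure (leb k) ?E \<le> ennreal (\<rho>\<^sup>2) * ennreal (29/30 * b ^ k)"
    using b by (subst (asm) ennreal_mult) auto
  then have E: "emeasure (leb k) ?E \<le> ennreal (29/30 * b ^ k)"
    using rho by (subst (asm) ennreal_mult_le_mult_iff) auto
  have "emeasure (leb k) ?B = emeasure (leb k) (?B \<inter> ball_in k y \<rho>) + emeasure (leb k) ?E"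
    by (subst plus_emeasure) (auto intro!: arg_cong[where f = "emeasure (leb k)"])
  then have "ennreal (b ^ k) \<le> emeasure (leb k) (?B \<inter> ball_in k y \<rho>) + ennreal (29/30 * b ^ k)"
    using add_left_mono[OF E] muB by simp
  then have "ennreal (b ^ k) - ennreal (29/30 * b ^ k) \<le> emeasure (leb k) (?B \<inter> ball_in k y \<rho>)"
    by (simp add: ennreal_minus_le_iff add.commute)
  moreover have "ennreal (b ^ k) - ennreal (29/30 * b ^ k) = ennreal (b ^ k / 30)"
    using b by (subst ennreal_minus) (auto simp: field_simps)
  ultimately show ?thesis by simp
qed

text \<open>Balls around points near a face leave the cube, so each point gets instead a box of side
  \<open>b\<close> inside the cube that contains it, cut down to the ball of radius 0.7 * \<delta>.
  Such a piece has volume at least b^k / 30, and since 2 * 0.7^2 = 0.98 < 1, no point lies in more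
  than 50 pieces; 1500 = 30 * 50. The factor 1.42 is just below 2.9 * 0.7^2.\<close>

lemma separated_cube_card_le:
  fixes b \<delta> :: real
  assumes fin: "finite Y" and Y: "Y \<subseteq> unit_cube k" and k: "k \<ge> 1"
    and delta: "0 < \<delta>" and sep: "\<And>x y. x \<in> Y \<Longrightarrow> y \<in> Y \<Longrightarrow> x \<noteq> y \<Longrightarrow> \<delta>\<^sup>2 \<le> sqdist k x y"
    and b: "0 < b" "b \<le> 1" and bk: "real k * b\<^sup>2 \<le> 142/100 * \<delta>\<^sup>2"
  shows "card Y * b ^ k \<le> 1500"
proof -
  \<comment> \<open>Lowering the left end to 1 - b where necessary keeps the box inside the cube,
    with \<open>y\<close> still in it.\<close>
  define l where "l y i = min (y i) (1 - b)" for y :: point and i :: nat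
  define A where "A y = (\<Pi>\<^sub>E i\<in>{..<k}. {l y i..l y i + b}) \<inter> ball_in k y (7/10 * \<delta>)" for y
  have box: "(\<Pi>\<^sub>E i\<in>{..<k}. {0..1::real}) \<in> sets (leb k)" by (rule sets_Box)
  have mu: "ennreal (b ^ k / 30) \<le> emeasure (leb k) (A y)" if "y \<in> Y" for y
    unfolding A_def
  proof (rule emeasure_Box_ball_ge)
    show "l y i \<le> y i \<and> y i \<le> l y i + b" if "i < k" for i
      using unit_cubeD[of y k i] \<open>y \<in> Y\<close> Y that b by (auto simp: l_def min_def)
    show "real k * b\<^sup>2 \<le> 29/10 * (7/10 * \<delta>)\<^sup>2"
    proof -
      have "(7/10 * \<delta>)\<^sup>2 = 49/100 * \<delta>\<^sup>2" by (simp add: power2_eq_square)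
      then show ?thesis using bk zero_le_power2[of \<delta>] by linarith
    qed
  qed (use b k delta in auto)
  have "(\<Sum>y\<in>Y. ennreal (b ^ k / 30)) \<le> (\<Sum>y\<in>Y. emeasure (leb k) (A y))"
    by (intro sum_mono mu)
  also have "\<dots> \<le> ennreal 50 * emeasure (leb k) (\<Pi>\<^sub>E i\<in>{..<k}. {0..1})"
  proof (rule overlap_measure_le[OF fin _ box])
    show "A y \<in> sets (leb k)" for y
      unfolding A_def by (intro sets.Int sets_Box sets_ball_in)
    show "A y \<subseteq> (\<Pi>\<^sub>E i\<in>{..<k}. {0..1})" if "y \<in> Y" for y
    proof -
      have "0 \<le> l y i \<and> l y i + b \<le> 1" if "i < k" for i
        using unit_cubeD[of y k i] \<open>y \<in> Y\<close> Y that b by (auto simp: l_def min_def)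
      then have "(\<Pi>\<^sub>E i\<in>{..<k}. {l y i..l y i + b}) \<subseteq> (\<Pi>\<^sub>E i\<in>{..<k}. {0..1})"
        by (intro PiE_mono) auto
      then show ?thesis unfolding A_def by (rule le_infI1)
    qed
    show "real (card {y \<in> Y. x \<in> A y}) \<le> 50" for x
    proof -
      let ?J = "{y \<in> Y. x \<in> A y}"
      have "(real (card ?J) - 1) * \<delta>\<^sup>2 \<le> 2 * card ?J * (49/100 * \<delta>\<^sup>2) \<or> ?J = {}"
      proof (rule separated_card_le[where f = "\<lambda>y n. x n - y n" and S = "{..<k}"])
        show "(\<Sum>n<k. (x n - y n)\<^sup>2) \<le> 49/100 * \<delta>\<^sup>2" if "y \<in> ?J" for y
          using that by (auto simp: A_def ball_in_def sqdist_def power2_eq_square)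
        show "\<delta>\<^sup>2 \<le> (\<Sum>n<k. ((x n - y n) - (x n - z n))\<^sup>2)" if "y \<in> ?J" "z \<in> ?J" "y \<noteq> z" for y z
          using sep[of z y] that by (simp add: sqdist_def)
      qed (use fin in auto)
      then show ?thesis
      proof
        assume "(real (card ?J) - 1) * \<delta>\<^sup>2 \<le> 2 * card ?J * (49/100 * \<delta>\<^sup>2)"
        then have "(real (card ?J) - 1) * \<delta>\<^sup>2 \<le> (98/100 * card ?J) * \<delta>\<^sup>2" by (simp add: mult_ac)
        then have "real (card ?J) - 1 \<le> 98/100 * card ?J"
          using delta by (subst (asm) mult_le_cancel_right_pos) auto
        then show ?thesis by simp
      next
        assume "?J = {}" then show ?thesis by (simp only: card.empty)
      qed
    qed
  qed simp
  also have "emeasure (leb k) (\<Pi>\<^sub>E i\<in>{..<k}. {0..1}) = 1"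
    by (subst emeasure_Box) auto
  finally have "ennreal (card Y * (b ^ k / 30)) \<le> ennreal 50"
    using b by (simp add: ennreal_of_nat_eq_real_of_nat ennreal_mult[symmetric])
  then have "card Y * (b ^ k / 30) \<le> 50" by (subst (asm) ennreal_le_iff) auto
  then show ?thesis by simp
qed

text \<open>The sum splits over the coordinates; for sorted a, b, c in the unit interval the three
  squares are 2 * (c - a)^2 minus the nonnegative 2 * (b - a) * (c - b).\<close>

lemma three_points_cube:
  assumes "x \<in> unit_cube k" "y \<in> unit_cube k" "z \<in> unit_cube k"
  shows "sqdist k x y + sqdist k y z + sqdist k x z \<le> 2 * real k"
proof -
  have *: "(a - b)\<^sup>2 + (b - c)\<^sup>2 + (a - c)\<^sup>2 \<le> 2"
    if "a \<le> b" "b \<le> c" "0 \<le> a" "c \<le> 1" for a b c :: real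
  proof -
    have "(a - b)\<^sup>2 + (b - c)\<^sup>2 + (a - c)\<^sup>2 = 2 * (c - a)\<^sup>2 - 2 * ((b - a) * (c - b))"
      by (simp add: power2_eq_square algebra_simps)
    also have "\<dots> \<le> 2 * 1\<^sup>2 - 0"
      using that by (intro diff_mono mult_left_mono power_mono) auto
    finally show ?thesis by simp
  qed
  have "(a - b)\<^sup>2 + (b - c)\<^sup>2 + (a - c)\<^sup>2 \<le> 2"
    if "0 \<le> a" "a \<le> 1" "0 \<le> b" "b \<le> 1" "0 \<le> c" "c \<le> 1" for a b c :: real
    using *[of a b c] *[of a c b] *[of b a c] *[of b c a] *[of c a b] *[of c b a] that
    by (smt (verit) power2_commute)
  then have "(\<Sum>i<k. (x i - y i)\<^sup>2 + (y i - z i)\<^sup>2 + (x i - z i)\<^sup>2) \<le> (\<Sum>i<k. 2)"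
    using unit_cubeD[OF assms(1)] unit_cubeD[OF assms(2)] unit_cubeD[OF assms(3)]
    by (intro sum_mono) simp
  then show ?thesis by (simp add: sqdist_def sum.distrib mult.commute)
qed

text \<open>Among three points of the cube the smallest distance is at most \<open>sqrt (2 * k / 3)\<close>; this
  keeps the side \<open>b\<close> of the boxes in the volume bound below 1.\<close>

lemma closest_pair_cube:
  assumes Y: "Y \<subseteq> unit_cube k" and k: "k \<ge> 1" and card: "card Y \<ge> 3"
  shows "\<exists>x\<in>Y. \<exists>y\<in>Y. x \<noteq> y \<and> euclid_dist k x y ^ k \<le> real k powr (k / 2) * (1500 * (169/200) ^ k / card Y)"
proof -
  have fin: "finite Y" using card by (metis card.infinite not_numeral_le_zero)
  define P where "P = {(x, y) \<in> Y \<times> Y. x \<noteq> y}"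
  obtain x y z where xyz: "x \<in> Y" "y \<in> Y" "z \<in> Y" "x \<noteq> y" "y \<noteq> z" "x \<noteq> z"
    using card by (auto simp: card_le_Suc_iff numeral_eq_Suc)
  have Pfin: "finite P" unfolding P_def by (rule finite_subset[of _ "Y \<times> Y"]) (use fin in auto)
  have "P \<noteq> {}" using xyz by (auto simp: P_def)
  then obtain p where p: "p \<in> P" and pmin: "\<And>q. q \<in> P \<Longrightarrow> sqdist k (fst p) (snd p) \<le> sqdist k (fst q) (snd q)"
    using ex_min_if_finite[of "(\<lambda>q. sqdist k (fst q) (snd q)) ` P"] Pfin by (auto simp: not_less)
  define \<delta> where "\<delta> = euclid_dist k (fst p) (snd p)"
  have min: "\<delta>\<^sup>2 \<le> sqdist k u v" if "u \<in> Y" "v \<in> Y" "u \<noteq> v" for u v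
    using pmin[of "(u, v)"] that by (auto simp: P_def \<delta>_def euclid_dist_power2)
  have d23: "3 * \<delta>\<^sup>2 \<le> 2 * real k"
  proof -
    have "x \<in> unit_cube k" "y \<in> unit_cube k" "z \<in> unit_cube k" using xyz Y by auto
    from three_points_cube[OF this] show ?thesis
      using min[of x y] min[of y z] min[of x z] xyz by linarith
  qed
  have concl: "\<delta> ^ k \<le> real k powr (k / 2) * (1500 * (169/200) ^ k / card Y)"
  proof (cases "\<delta> = 0")
    case True
    then show ?thesis using k by (simp add: zero_power)
  next
    case False
    then have dpos: "\<delta> > 0" by (simp add: \<delta>_def less_le)
    \<comment> \<open>The factor 1.19 nearly exhausts the admissible 1.42, as 1.19^2 = 1.4161. With
      3 * \<delta>^2 \<le> 2 * k it gives b^2 \<le> 0.945, and 1 / 1.19 < 0.845 = 169/200 is the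
      rate in the conclusion.\<close>
    define b where "b = 119/100 * \<delta> / sqrt k"
    have kb: "real k * b\<^sup>2 = 14161/10000 * \<delta>\<^sup>2"
      using k by (simp add: b_def power_divide power_mult_distrib)
    have bpos: "b > 0" using dpos k by (simp add: b_def)
    have "real k * b\<^sup>2 \<le> real k * 1\<^sup>2" using d23 kb by simp
    then have "b\<^sup>2 \<le> 1\<^sup>2" using k by (simp only: mult_le_cancel_left_pos of_nat_0_less_iff)
    then have "b \<le> 1" by (rule power2_le_imp_le) simp
    then have "card Y * b ^ k \<le> 1500"
    proof (intro separated_cube_card_le[OF fin Y k dpos] min)
      show "real k * b\<^sup>2 \<le> 142/100 * \<delta>\<^sup>2" using kb zero_le_power2[of \<delta>] by linarith
    qed (use bpos in auto)
    then have bk: "b ^ k \<le> 1500 / card Y" using card by (simp add: field_simps)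
    have "\<delta> = sqrt k * (b * (100 / 119))" using k by (simp add: b_def)
    then have "\<delta> ^ k = sqrt k ^ k * (b ^ k * (100 / 119) ^ k)" by (metis power_mult_distrib)
    also have "sqrt k ^ k = real k powr (k / 2)"
      using k by (simp add: powr_half_sqrt[symmetric] powr_powr powr_realpow[symmetric])
    also have "real k powr (k / 2) * (b ^ k * (100 / 119) ^ k)
        \<le> real k powr (k / 2) * (1500 / card Y * (169/200) ^ k)"
      using bk bpos by (intro mult_left_mono mult_mono power_mono) auto
    finally show ?thesis by simp
  qed
  have "fst p \<in> Y" "snd p \<in> Y" "fst p \<noteq> snd p" using p by (auto simp: P_def)
  with concl show ?thesis unfolding \<delta>_def by blast
qed

section \<open>Short edges\<close>

lemma sum_pair_bool:
  fixes g :: "nat \<times> bool \<Rightarrow> real"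
  shows "(\<Sum>n\<in>{..<k} \<times> UNIV. g n) = (\<Sum>n<k. g (n, True) + g (n, False))"
proof -
  have "(\<Sum>n\<in>{..<k} \<times> UNIV. g n) = (\<Sum>n<k. \<Sum>s\<in>UNIV. g (n, s))"
    by (simp add: sum.cartesian_product)
  then show ?thesis by (simp add: UNIV_bool add.commute)
qed

text \<open>In \<open>\<real>\<^sup>2\<^sup>k\<close> the vectors \<open>(a i - x - c \<theta>, b i - x + c \<theta>)\<close> are as far apart as the edges. The shift
  \<open>c\<close> is the one that makes them shortest; their squared norms then stay below half the squared
  separation, so a bounded number of them fits.\<close>

lemma overlap_window_card_le:
  fixes a b :: "'i \<Rightarrow> point" and x \<theta> :: point and D :: real and k :: nat
  defines "d \<equiv> \<lambda>i. euclid_dist k (a i) (b i)"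
  assumes fin: "finite J" and D: "D > 0"
    and win: "\<And>i. i \<in> J \<Longrightarrow> 999/1000 * D \<le> d i \<and> d i \<le> D"
    and near: "\<And>i. i \<in> J \<Longrightarrow> sqdist k x (\<lambda>n. (a i n + b i n) / 2) \<le> (35/100 * d i)\<^sup>2"
    and dir: "\<And>i. i \<in> J \<Longrightarrow> 71/100 * d i \<le> (\<Sum>n<k. \<theta> n * (a i n - b i n))"
    and theta: "(\<Sum>n<k. (\<theta> n)\<^sup>2) \<le> 1"
    and sep: "\<And>i j. i \<in> J \<Longrightarrow> j \<in> J \<Longrightarrow> i \<noteq> j \<Longrightarrow>
                999/1000 * (d i)\<^sup>2 \<le> sqdist k (a i) (a j) + sqdist k (b i) (b j)"
  shows "card J \<le> 99"
proof -
  \<comment> \<open>2 * c^2 - 2 * c * (0.71 * D) is minimal at c = 0.71 * D / 2. For an edge of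
    length D the squared norm is then at most (1/2 + 2 * 0.35^2 - 0.71^2 / 2) * D^2, which is below
    D^2 / 2 because 0.35 < 0.71 / 2.\<close>
  define c where "c = 355/1000 * D"
  define f where "f i = (\<lambda>(n, s). if s then a i n - x n - c * \<theta> n else b i n - x n + c * \<theta> n)" for i
  have "(real (card J) - 1) * (997/1000 * D\<^sup>2) \<le> 2 * card J * (4935/10000 * D\<^sup>2) \<or> J = {}"
  proof (rule separated_card_le[where f = f and S = "{..<k} \<times> UNIV", OF fin])
    fix i assume i: "i \<in> J"
    have dD: "999/1000 * D \<le> d i" "d i \<le> D" using win[OF i] by auto
    have "(\<Sum>n\<in>{..<k} \<times> UNIV. (f i n)\<^sup>2)
       = (\<Sum>n<k. (a i n - x n - c * \<theta> n)\<^sup>2 + (b i n - x n + c * \<theta> n)\<^sup>2)"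
      by (subst sum_pair_bool) (simp add: f_def)
    \<comment> \<open>Parallelogram law: the two vectors have half sum midpoint minus x, and
      difference a - b - 2 * c * \<theta>.\<close>
    also have "\<dots> = (\<Sum>n<k. 2 * (x n - (a i n + b i n) / 2)\<^sup>2 + (1/2 * (a i n - b i n)\<^sup>2
         - 2 * c * (\<theta> n * (a i n - b i n)) + 2 * c\<^sup>2 * (\<theta> n)\<^sup>2))"
      by (intro sum.cong refl) (simp add: power2_eq_square field_simps)
    also have "\<dots> = 2 * sqdist k x (\<lambda>n. (a i n + b i n) / 2) + (1/2 * (d i)\<^sup>2
         - 2 * c * (\<Sum>n<k. \<theta> n * (a i n - b i n)) + 2 * c\<^sup>2 * (\<Sum>n<k. (\<theta> n)\<^sup>2))"
      by (simp only: sqdist_def d_def euclid_dist_power2 sum.distrib sum_subtractf sum_distrib_left)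
    also have "\<dots> \<le> 2 * (35/100 * d i)\<^sup>2 + (1/2 * (d i)\<^sup>2 - 2 * c * (71/100 * d i) + 2 * c\<^sup>2 * 1)"
      using near[OF i] dir[OF i] theta D
      by (intro add_mono diff_mono mult_left_mono) (auto simp: c_def)
    also have "\<dots> = 745/1000 * (d i)\<^sup>2 - 5041/10000 * (D * d i) + 25205/100000 * D\<^sup>2"
      by (simp add: c_def power2_eq_square)
    \<comment> \<open>The terms are bounded separately, with d at most D in the first and at least
      0.999 * D in the second; the narrow window of lengths keeps this loss small.\<close>
    also have "\<dots> \<le> 745/1000 * D\<^sup>2 - 5041/10000 * (D * (999/1000 * D)) + 25205/100000 * D\<^sup>2"
      using D dD by (intro add_mono diff_mono mult_left_mono power_mono) (auto simp: d_def)
    also have "\<dots> \<le> 4935/10000 * D\<^sup>2"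
      by (simp add: power2_eq_square)
    finally show "(\<Sum>n\<in>{..<k} \<times> UNIV. (f i n)\<^sup>2) \<le> 4935/10000 * D\<^sup>2" .
  next
    fix i j assume ij: "i \<in> J" "j \<in> J" "i \<noteq> j"
    have "997/1000 * D\<^sup>2 \<le> 999/1000 * (999/1000 * D)\<^sup>2"
      by (simp add: power2_eq_square)
    also have "\<dots> \<le> 999/1000 * (d i)\<^sup>2"
      using win[OF ij(1)] D by (intro mult_left_mono power_mono) auto
    also have "\<dots> \<le> sqdist k (a i) (a j) + sqdist k (b i) (b j)" by (rule sep[OF ij])
    also have "\<dots> = (\<Sum>n\<in>{..<k} \<times> UNIV. (f i n - f j n)\<^sup>2)"
      by (subst sum_pair_bool) (simp add: f_def sqdist_def sum.distrib)
    finally show "997/1000 * D\<^sup>2 \<le> (\<Sum>n\<in>{..<k} \<times> UNIV. (f i n - f j n)\<^sup>2)" .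
  qed
  then show ?thesis
  proof
    assume "(real (card J) - 1) * (997/1000 * D\<^sup>2) \<le> 2 * card J * (4935/10000 * D\<^sup>2)"
    then have "(997/1000 * (real (card J) - 1)) * D\<^sup>2 \<le> (987/1000 * card J) * D\<^sup>2" by (simp add: algebra_simps)
    then have "997/1000 * (real (card J) - 1) \<le> 987/1000 * card J"
      using D by (subst (asm) mult_le_cancel_right_pos) auto
    then show ?thesis by simp
  qed simp
qed

text \<open>If edge j were less than a tenth as long as edge i, both its ends would lie close to x
  compared with \<open>d i\<close>, so the distances in \<open>sep\<close> would hardly exceed those
  from \<open>a i\<close> and \<open>b i\<close> to x. The squares of the latter add up to at most
  0.745 * (d i)^2, too little for \<open>sep\<close>.\<close>

lemma overlap_scale_ratio:
  fixes a b :: "'i \<Rightarrow> point" and x :: point and k :: nat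
  defines "d \<equiv> \<lambda>i. euclid_dist k (a i) (b i)"
  assumes near: "\<And>l. l \<in> {i, j} \<Longrightarrow> sqdist k x (\<lambda>n. (a l n + b l n) / 2) \<le> (35/100 * d l)\<^sup>2"
    and di: "d i > 0"
    and sep: "999/1000 * (d i)\<^sup>2 \<le> sqdist k (a i) (a j) + sqdist k (b i) (b j)"
  shows "d i \<le> 10 * d j"
proof (rule ccontr)
  assume "\<not> d i \<le> 10 * d j"
  then have "d j < d i / 10" by simp
  then have dj: "(d j)\<^sup>2 \<le> (d i / 10)\<^sup>2" by (intro power_mono) (auto simp: d_def)
  define g where "g l = (\<Sum>n<k. (a l n - x n)\<^sup>2 + (b l n - x n)\<^sup>2)" for l
  have g: "g l \<le> 745/1000 * (d l)\<^sup>2" if l: "l \<in> {i, j}" for l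
  proof -
    have "g l = (\<Sum>n<k. 2 * (x n - (a l n + b l n) / 2)\<^sup>2 + 1/2 * (a l n - b l n)\<^sup>2)"
      unfolding g_def by (intro sum.cong refl) (simp add: power2_eq_square field_simps)
    also have "\<dots> = 2 * sqdist k x (\<lambda>n. (a l n + b l n) / 2) + 1/2 * (d l)\<^sup>2"
      by (simp only: sqdist_def d_def euclid_dist_power2 sum.distrib sum_distrib_left)
    also have "\<dots> \<le> 2 * (35/100 * d l)\<^sup>2 + 1/2 * (d l)\<^sup>2"
      using near[OF l] by simp
    finally show ?thesis by (simp add: power2_eq_square)
  qed
  \<comment> \<open>Young's inequality with weights 1 + 1/10 and 1 + 10; the resulting total 1.1 *
    0.745 + 11 * 0.745 / 100 is about 0.9, below 0.999.\<close>
  have sq: "(u - v)\<^sup>2 \<le> 11/10 * u\<^sup>2 + 11 * v\<^sup>2" for u v :: real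
  proof -
    have "11/10 * u\<^sup>2 + 11 * v\<^sup>2 - (u - v)\<^sup>2 = 1/10 * (u + 10 * v)\<^sup>2"
      by (simp add: power2_eq_square algebra_simps)
    then show ?thesis using zero_le_power2[of "u + 10 * v"] by linarith
  qed
  have "sqdist k (a i) (a j) + sqdist k (b i) (b j)
      = (\<Sum>n<k. ((a i n - x n) - (a j n - x n))\<^sup>2 + ((b i n - x n) - (b j n - x n))\<^sup>2)"
    by (simp add: sqdist_def sum.distrib)
  also have "\<dots> \<le> (\<Sum>n<k. 11/10 * ((a i n - x n)\<^sup>2 + (b i n - x n)\<^sup>2) + 11 * ((a j n - x n)\<^sup>2 + (b j n - x n)\<^sup>2))"
  proof (intro sum_mono)
    fix n
    show "((a i n - x n) - (a j n - x n))\<^sup>2 + ((b i n - x n) - (b j n - x n))\<^sup>2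
      \<le> 11/10 * ((a i n - x n)\<^sup>2 + (b i n - x n)\<^sup>2) + 11 * ((a j n - x n)\<^sup>2 + (b j n - x n)\<^sup>2)"
      using sq[of "a i n - x n" "a j n - x n"] sq[of "b i n - x n" "b j n - x n"] by argo
  qed
  also have "\<dots> = 11/10 * g i + 11 * g j"
    by (simp only: g_def sum.distrib sum_distrib_left[symmetric])
  also have "\<dots> \<le> 11/10 * (745/1000 * (d i)\<^sup>2) + 11 * (745/1000 * (d i / 10)\<^sup>2)"
    using g[of i] g[of j] dj by simp
  also have "\<dots> < 999/1000 * (d i)\<^sup>2"
    using di by (simp add: power2_eq_square)
  finally show False using sep by simp
qed

text \<open>All lengths lie within a factor 10 of the longest one, m. They are sorted into windows
  of width m / 10000, numbered from 1000 on, so that lengths in one window agree up to the factor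
  0.999. There are at most 10001 windows with at most 99 edges each.\<close>

lemma overlap_card_le:
  fixes a b :: "'i \<Rightarrow> point" and x \<theta> :: point and k :: nat
  defines "d \<equiv> \<lambda>i. euclid_dist k (a i) (b i)"
  assumes fin: "finite J" and dpos: "\<And>i. i \<in> J \<Longrightarrow> d i > 0"
    and near: "\<And>i. i \<in> J \<Longrightarrow> sqdist k x (\<lambda>n. (a i n + b i n) / 2) \<le> (35/100 * d i)\<^sup>2"
    and dir: "\<And>i. i \<in> J \<Longrightarrow> 71/100 * d i \<le> (\<Sum>n<k. \<theta> n * (a i n - b i n))"
    and theta: "(\<Sum>n<k. (\<theta> n)\<^sup>2) \<le> 1"
    and sep: "\<And>i j. i \<in> J \<Longrightarrow> j \<in> J \<Longrightarrow> i \<noteq> j \<Longrightarrow>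
                999/1000 * (d i)\<^sup>2 \<le> sqdist k (a i) (a j) + sqdist k (b i) (b j)"
  shows "card J \<le> 1000000"
proof (cases "J = {}")
  case False
  define m where "m = Max (d ` J)"
  have "m \<in> d ` J" unfolding m_def using fin False by (intro Max_in) auto
  then obtain i0 where i0: "i0 \<in> J" "m = d i0" by auto
  have mpos: "m > 0" using i0 dpos by simp
  have le_m: "d i \<le> m" if "i \<in> J" for i
    unfolding m_def using fin that by (intro Max_ge) auto
  have ge_m: "m \<le> 10 * d i" if i: "i \<in> J" for i
  proof (cases "i = i0")
    case True then show ?thesis using i0 mpos by simp
  next
    case False
    then show ?thesis
      using overlap_scale_ratio[of i0 i k x a b] near sep[OF i0(1) i] i0 i dpos[OF i0(1)]
      unfolding d_def by auto
  qed
  define w where "w i = nat \<lfloor>10000 * d i / m\<rfloor>" for i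
  have w: "real (w i) \<le> 10000 * d i / m" "10000 * d i / m < real (w i) + 1"
    "1000 \<le> w i" "w i \<le> 10000" if i: "i \<in> J" for i
  proof -
    have ge: "1000 \<le> 10000 * d i / m" using ge_m[OF i] mpos by (simp add: field_simps)
    then show "real (w i) \<le> 10000 * d i / m" "10000 * d i / m < real (w i) + 1"
      unfolding w_def by linarith+
    show "1000 \<le> w i" using ge unfolding w_def by linarith
    have "10000 * d i / m \<le> 10000" using le_m[OF i] mpos by (simp add: field_simps)
    then show "w i \<le> 10000" unfolding w_def by linarith
  qed
  have "card J = card (\<Union>v\<in>w ` J. {i\<in>J. w i = v})"
    by (rule arg_cong[where f = card]) auto
  also have "\<dots> \<le> (\<Sum>v\<in>w ` J. card {i\<in>J. w i = v})"
    using fin by (intro card_UN_le) auto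
  also have "\<dots> \<le> (\<Sum>v\<in>w ` J. 99)"
  proof (intro sum_mono)
    fix v assume "v \<in> w ` J"
    then obtain i1 where i1: "i1 \<in> J" "v = w i1" by auto
    define D where "D = (real v + 1) * m / 10000"
    show "card {i\<in>J. w i = v} \<le> 99"
    proof (rule overlap_window_card_le[of _ D k a b x \<theta>])
      show "D > 0" using mpos by (simp add: D_def)
      fix i assume i: "i \<in> {i\<in>J. w i = v}"
      then have iJ: "i \<in> J" and wi: "w i = v" by auto
      have "999/1000 * (real v + 1) \<le> real v" using w(3)[OF iJ] wi by simp
      then have "999/1000 * (real v + 1) \<le> 10000 * d i / m" using w(1)[OF iJ] wi by simp
      then have 1: "999/1000 * D \<le> d i" using mpos by (simp add: D_def field_simps)
      have "d i \<le> D" using w(2)[OF iJ] mpos wi by (simp add: D_def field_simps)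
      with 1 show "999/1000 * D \<le> euclid_dist k (a i) (b i) \<and> euclid_dist k (a i) (b i) \<le> D"
        by (simp add: d_def)
    qed (use fin theta near dir sep in \<open>auto simp: d_def\<close>)
  qed
  also have "\<dots> = card (w ` J) * 99" by simp
  also have "\<dots> \<le> card {..10000::nat} * 99"
    using w(4) by (intro mult_right_mono card_mono) auto
  finally show ?thesis by simp
qed simp

section \<open>Caps of directions in the unit ball\<close>

lemma cap_contains_ball:
  fixes v \<theta> :: point
  assumes v: "(\<Sum>n<k. (v n)\<^sup>2) = 1" and t: "sqdist k \<theta> (\<lambda>n. 855/1000 * v n) \<le> (145/1000)\<^sup>2"
  shows "(\<Sum>n<k. (\<theta> n)\<^sup>2) \<le> 1" "71/100 \<le> (\<Sum>n<k. \<theta> n * v n)"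
proof -
  \<comment> \<open>The offset from 0.855 * v has norm at most 0.145, and 0.855 + 0.145 = 1 while
    0.855 - 0.145 = 0.71. This crude inscribed ball gives a positive cap volume in every
    dimension.\<close>
  define h where "h n = \<theta> n - 855/1000 * v n" for n
  define s where "s = (\<Sum>n<k. h n * v n)"
  have h: "(\<Sum>n<k. (h n)\<^sup>2) \<le> (145/1000)\<^sup>2" using t by (simp add: sqdist_def h_def)
  have "s\<^sup>2 \<le> (\<Sum>n<k. (h n)\<^sup>2) * (\<Sum>n<k. (v n)\<^sup>2)"
    unfolding s_def by (rule Cauchy_Schwarz_ineq_sum)
  then have "s\<^sup>2 \<le> (145/1000)\<^sup>2" using v h by simp
  then have s: "\<bar>s\<bar> \<le> 145/1000" using abs_le_square_iff[of s "145/1000"] by simp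
  have "(\<Sum>n<k. (\<theta> n)\<^sup>2) = (\<Sum>n<k. (855/1000)\<^sup>2 * (v n)\<^sup>2 + 2 * (855/1000) * (h n * v n) + (h n)\<^sup>2)"
    by (intro sum.cong refl) (simp add: h_def power2_eq_square algebra_simps)
  also have "\<dots> = (855/1000)\<^sup>2 + 2 * (855/1000) * s + (\<Sum>n<k. (h n)\<^sup>2)"
    by (simp only: sum.distrib sum_distrib_left[symmetric] v s_def mult_1_right)
  also have "\<dots> \<le> (855/1000)\<^sup>2 + 2 * (855/1000) * (145/1000) + (145/1000)\<^sup>2"
    using h s by (intro add_mono) auto
  finally show "(\<Sum>n<k. (\<theta> n)\<^sup>2) \<le> 1" by (simp add: power2_eq_square)
  have "(\<Sum>n<k. \<theta> n * v n) = (\<Sum>n<k. 855/1000 * (v n)\<^sup>2 + h n * v n)"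
    by (intro sum.cong refl) (simp add: h_def power2_eq_square algebra_simps)
  also have "\<dots> = 855/1000 + s"
    by (simp only: sum.distrib sum_distrib_left[symmetric] v s_def mult_1_right)
  finally show "71/100 \<le> (\<Sum>n<k. \<theta> n * v n)" using s by simp
qed

text \<open>The part of the ball around \<open>0.711 v\<close> that sticks out of the cap has \<open>|(\<theta> - 0.711 v) \<bullet> v| > 0.001\<close>
  and is contained in two balls of slightly smaller radius, whose relative volume is exponentially
  small.\<close>

lemma cap_cover:
  fixes v \<theta> :: point
  assumes v: "(\<Sum>n<k. (v n)\<^sup>2) = 1" and t: "sqdist k \<theta> (\<lambda>n. 711/1000 * v n) \<le> (7/10)\<^sup>2"
  shows "(\<Sum>n<k. (\<theta> n)\<^sup>2) \<le> 1 \<and> 71/100 \<le> (\<Sum>n<k. \<theta> n * v n) \<or>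
         sqdist k \<theta> (\<lambda>n. 712/1000 * v n) \<le> 489999/1000000 \<or>
         sqdist k \<theta> (\<lambda>n. 710/1000 * v n) \<le> 489999/1000000"
proof -
  define h where "h n = \<theta> n - 711/1000 * v n" for n
  define s where "s = (\<Sum>n<k. h n * v n)"
  have h: "(\<Sum>n<k. (h n)\<^sup>2) \<le> (7/10)\<^sup>2" using t by (simp add: sqdist_def h_def)
  have shift: "sqdist k \<theta> (\<lambda>n. (711/1000 + \<tau>) * v n) = (\<Sum>n<k. (h n)\<^sup>2) - 2 * \<tau> * s + \<tau>\<^sup>2" for \<tau>
  proof -
    have "sqdist k \<theta> (\<lambda>n. (711/1000 + \<tau>) * v n) = (\<Sum>n<k. (h n)\<^sup>2 - 2 * \<tau> * (h n * v n) + \<tau>\<^sup>2 * (v n)\<^sup>2)"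
      unfolding sqdist_def by (intro sum.cong refl) (simp add: h_def power2_eq_square algebra_simps)
    then show ?thesis by (simp only: sum.distrib sum_subtractf sum_distrib_left[symmetric] v s_def mult_1_right)
  qed
  \<comment> \<open>In the middle case 0.711 - 0.001 = 0.71 and 0.711^2 + 2 * 0.711 * 0.001 + 0.49 <
    1. In the outer cases moving the centre by 0.001 along v, in the direction given by the sign of
    s, lowers the squared distance by at least 2 * 10^-6 - 10^-6, whence 0.489999.\<close>
  consider "\<bar>s\<bar> \<le> 1/1000" | "s > 1/1000" | "s < -1/1000" by linarith
  then show ?thesis
  proof cases
    case 1
    have "(\<Sum>n<k. (\<theta> n)\<^sup>2) = (\<Sum>n<k. (711/1000)\<^sup>2 * (v n)\<^sup>2 + 2 * (711/1000) * (h n * v n) + (h n)\<^sup>2)"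
      by (intro sum.cong refl) (simp add: h_def power2_eq_square algebra_simps)
    also have "\<dots> = (711/1000)\<^sup>2 + 2 * (711/1000) * s + (\<Sum>n<k. (h n)\<^sup>2)"
      by (simp only: sum.distrib sum_distrib_left[symmetric] v s_def mult_1_right)
    also have "\<dots> \<le> (711/1000)\<^sup>2 + 2 * (711/1000) * (1/1000) + (7/10)\<^sup>2"
      using h 1 by (intro add_mono) auto
    also have "\<dots> \<le> 1" by (simp add: power2_eq_square)
    finally have "(\<Sum>n<k. (\<theta> n)\<^sup>2) \<le> 1" .
    moreover have "(\<Sum>n<k. \<theta> n * v n) = (\<Sum>n<k. 711/1000 * (v n)\<^sup>2 + h n * v n)"
      by (intro sum.cong refl) (simp add: h_def power2_eq_square algebra_simps)
    then have "(\<Sum>n<k. \<theta> n * v n) = 711/1000 + s"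
      by (simp only: sum.distrib sum_distrib_left[symmetric] v s_def mult_1_right)
    ultimately show ?thesis using 1 by (intro disjI1 conjI) linarith+
  next
    case 2
    then show ?thesis using h shift[of "1/1000"] by (simp add: power2_eq_square)
  next
    case 3
    then show ?thesis using h shift[of "-1/1000"] by (simp add: power2_eq_square)
  qed
qed

text \<open>Directions range over the unit ball instead of the sphere, so that averaging is
  integration against Lebesgue measure. The threshold 0.71 balances two demands: it has to exceed
  twice the radius factor 0.35 of the midpoint balls, and the cap should still fill about 0.7^k of
  the ball.\<close>

definition cap :: "nat \<Rightarrow> point \<Rightarrow> point set" where
  "cap k v = {\<theta> \<in> space (leb k). (\<Sum>n<k. (\<theta> n)\<^sup>2) \<le> 1 \<and> 71/100 \<le> (\<Sum>n<k. \<theta> n * v n)}"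

lemma sets_cap [measurable]: "cap k v \<in> sets (leb k)"
  unfolding cap_def by measurable

text \<open>The first argument of the maximum only matters for small \<open>k\<close>, where the second one may be
  negative.\<close>

definition cap_fraction :: "nat \<Rightarrow> real" where
  "cap_fraction k = max ((145/1000) ^ k) ((7/10) ^ k - 2 * sqrt (489999/1000000) ^ k)"

lemma cap_fraction_pos: "cap_fraction k > 0"
  unfolding cap_fraction_def by (rule less_le_trans[OF _ max.cobounded1]) simp

text \<open>The first term of the maximum is the volume of the inscribed ball. The second is that of
  the ball of radius 0.7 minus the two balls that cover its part outside the cap.\<close>

lemma emeasure_cap_ge:
  assumes v: "(\<Sum>n<k. (v n)\<^sup>2) = 1"
  shows "ennreal (unit_ball_vol k * cap_fraction k) \<le> emeasure (leb k) (cap k v)"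
proof -
  let ?V = "unit_ball_vol k"
  have V: "?V > 0" by simp
  have "ball_in k (\<lambda>n. 855/1000 * v n) (145/1000) \<subseteq> cap k v"
    using cap_contains_ball[OF v] by (auto simp: ball_in_def cap_def)
  then have "emeasure (leb k) (ball_in k (\<lambda>n. 855/1000 * v n) (145/1000)) \<le> emeasure (leb k) (cap k v)"
    by (intro emeasure_mono) auto
  then have 1: "ennreal (?V * (145/1000) ^ k) \<le> emeasure (leb k) (cap k v)"
    by (simp add: emeasure_ball_in)
  define q where "q = sqrt (489999/1000000)"
  have q: "q > 0" "q\<^sup>2 = 489999/1000000" by (auto simp: q_def)
  let ?E = "\<lambda>c. ball_in k (\<lambda>n. c * v n) q"
  have "ball_in k (\<lambda>n. 711/1000 * v n) (7/10) \<subseteq> cap k v \<union> (?E (712/1000) \<union> ?E (710/1000))"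
    using cap_cover[OF v] unfolding ball_in_def cap_def q(2) by blast
  then have "emeasure (leb k) (ball_in k (\<lambda>n. 711/1000 * v n) (7/10))
      \<le> emeasure (leb k) (cap k v \<union> (?E (712/1000) \<union> ?E (710/1000)))"
    by (intro emeasure_mono) auto
  also have "\<dots> \<le> emeasure (leb k) (cap k v) + emeasure (leb k) (?E (712/1000) \<union> ?E (710/1000))"
    by (intro emeasure_subadditive) auto
  also have "\<dots> \<le> emeasure (leb k) (cap k v) + (emeasure (leb k) (?E (712/1000)) + emeasure (leb k) (?E (710/1000)))"
    by (intro add_left_mono emeasure_subadditive) auto
  also have "\<dots> = ennreal (?V * (2 * q ^ k)) + emeasure (leb k) (cap k v)"
    using q V by (simp add: emeasure_ball_in ennreal_plus[symmetric] add.commute mult.left_commute del: ennreal_plus)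
  finally have "ennreal (?V * (7/10) ^ k) \<le> ennreal (?V * (2 * q ^ k)) + emeasure (leb k) (cap k v)"
    by (simp add: emeasure_ball_in)
  then have "ennreal (?V * (7/10) ^ k) - ennreal (?V * (2 * q ^ k)) \<le> emeasure (leb k) (cap k v)"
    by (simp add: ennreal_minus_le_iff)
  then have 2: "ennreal (?V * ((7/10) ^ k - 2 * q ^ k)) \<le> emeasure (leb k) (cap k v)"
    using q V by (subst (asm) ennreal_minus) (auto simp: right_diff_distrib)
  show ?thesis
    using 1 2 unfolding cap_fraction_def q_def[symmetric] by (simp add: max_def)
qed

section \<open>Volume comparison and averaging over directions\<close>

lemma ball_midpoint_subset_box:
  assumes "a \<in> unit_cube k" "b \<in> unit_cube k" and d: "0 \<le> d" "d \<le> D"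
  shows "ball_in k (\<lambda>n. (a n + b n) / 2) (35/100 * d) \<subseteq> (\<Pi>\<^sub>E i\<in>{..<k}. {- D..1 + D})"
proof
  fix x assume x: "x \<in> ball_in k (\<lambda>n. (a n + b n) / 2) (35/100 * d)"
  have "x i \<in> {-D..1 + D}" if i: "i < k" for i
  proof -
    have "(x i - (a i + b i) / 2)\<^sup>2 \<le> sqdist k x (\<lambda>n. (a n + b n) / 2)"
      unfolding sqdist_def using i by (intro member_le_sum[of i "{..<k}" "\<lambda>i. (x i - (a i + b i) / 2)\<^sup>2"]) auto
    also have "\<dots> \<le> (35/100 * d)\<^sup>2" using x by (simp add: ball_in_def)
    finally have "\<bar>x i - (a i + b i) / 2\<bar> \<le> \<bar>35/100 * d\<bar>" by (simp only: abs_le_square_iff)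
    then have "\<bar>x i - (a i + b i) / 2\<bar> \<le> D" using d by linarith
    then show ?thesis using unit_cubeD[OF assms(1) i] unit_cubeD[OF assms(2) i]
      by (simp add: abs_le_iff field_simps)
  qed
  then show "x \<in> (\<Pi>\<^sub>E i\<in>{..<k}. {- D..1 + D})"
    using x by (auto simp: ball_in_def space_PiM PiE_iff)
qed

text \<open>The balls of radius 0.35 * d i around the midpoints stay in a box of side 1 + 2 * D and
  cover no point more than 1000000 times, so their total volume is at most that multiple of the
  volume of the box.\<close>

lemma short_edges_directed_sum_le:
  fixes a b :: "'i \<Rightarrow> point" and \<theta> :: point and k :: nat
  defines "d \<equiv> \<lambda>i. euclid_dist k (a i) (b i)"
  assumes fin: "finite I"
    and cube: "\<And>i. i \<in> I \<Longrightarrow> a i \<in> unit_cube k \<and> b i \<in> unit_cube k"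
    and dpos: "\<And>i. i \<in> I \<Longrightarrow> 0 < d i \<and> d i \<le> D" and D: "D > 0"
    and sep: "\<And>i j. i \<in> I \<Longrightarrow> j \<in> I \<Longrightarrow> i \<noteq> j \<Longrightarrow>
                999/1000 * (d i)\<^sup>2 \<le> sqdist k (a i) (a j) + sqdist k (b i) (b j)"
    and theta: "(\<Sum>n<k. (\<theta> n)\<^sup>2) \<le> 1"
  shows "(\<Sum>i | i \<in> I \<and> 71/100 * d i \<le> (\<Sum>n<k. \<theta> n * (a i n - b i n)). d i ^ k)
     \<le> 1000000 * (1 + 2 * D) ^ k / (unit_ball_vol k * (35/100) ^ k)"
proof -
  let ?I = "{i \<in> I. 71/100 * d i \<le> (\<Sum>n<k. \<theta> n * (a i n - b i n))}"
  let ?B = "\<lambda>i. ball_in k (\<lambda>n. (a i n + b i n) / 2) (35/100 * d i)"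
  let ?V = "unit_ball_vol k"
  have box: "(\<Pi>\<^sub>E i\<in>{..<k}. {-D..1 + D}) \<in> sets (leb k)" by (rule sets_Box)
  have "(\<Sum>i\<in>?I. ennreal (?V * (35/100 * d i) ^ k)) = (\<Sum>i\<in>?I. emeasure (leb k) (?B i))"
    using dpos by (intro sum.cong) (auto simp: emeasure_ball_in)
  also have "\<dots> \<le> ennreal 1000000 * emeasure (leb k) (\<Pi>\<^sub>E i\<in>{..<k}. {-D..1 + D})"
  proof (rule overlap_measure_le[OF _ _ box])
    show "finite ?I" using fin by simp
    show "?B i \<subseteq> (\<Pi>\<^sub>E i\<in>{..<k}. {- D..1 + D})" if "i \<in> ?I" for i
      using that cube[of i] dpos[of i] by (intro ball_midpoint_subset_box) auto
    show "real (card {i \<in> ?I. x \<in> ?B i}) \<le> 1000000" for x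
    proof -
      have "card {i \<in> ?I. x \<in> ?B i} \<le> 1000000"
        by (rule overlap_card_le[of _ k a b x \<theta>])
           (use fin dpos theta sep in \<open>auto simp: d_def ball_in_def\<close>)
      then show ?thesis by simp
    qed
  qed auto
  also have "emeasure (leb k) (\<Pi>\<^sub>E i\<in>{..<k}. {-D..1 + D}) = ennreal ((1 + 2 * D) ^ k)"
    using D by (subst emeasure_Box) (auto simp: algebra_simps)
  also have "ennreal 1000000 * \<dots> = ennreal (1000000 * (1 + 2 * D) ^ k)"
    using D by (intro ennreal_mult[symmetric]) auto
  also have "(\<Sum>i\<in>?I. ennreal (?V * (35/100 * d i) ^ k)) = ennreal (\<Sum>i\<in>?I. ?V * (35/100 * d i) ^ k)"
    by (intro sum_ennreal) (simp add: d_def)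
  finally have "(\<Sum>i\<in>?I. ?V * (35/100 * d i) ^ k) \<le> 1000000 * (1 + 2 * D) ^ k"
    using D by (subst (asm) ennreal_le_iff) auto
  also have "(\<Sum>i\<in>?I. ?V * (35/100 * d i) ^ k) = (?V * (35/100) ^ k) * (\<Sum>i\<in>?I. d i ^ k)"
    unfolding sum_distrib_left by (intro sum.cong refl) (simp only: power_mult_distrib mult.assoc)
  finally show ?thesis
    by (subst pos_le_divide_eq) (simp_all add: mult.commute)
qed

text \<open>Integrating the bound for a fixed \<theta> over the unit ball counts each edge with the
  volume of the cap around its own direction. That volume is at least the fraction
  \<open>cap_fraction k\<close> of the ball, whatever the direction, so dropping the restriction on
  directions costs division by this fraction.\<close>

lemma short_edges_sum_le:
  fixes a b :: "'i \<Rightarrow> point" and k :: nat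
  defines "d \<equiv> \<lambda>i. euclid_dist k (a i) (b i)"
  assumes fin: "finite I"
    and cube: "\<And>i. i \<in> I \<Longrightarrow> a i \<in> unit_cube k \<and> b i \<in> unit_cube k"
    and dpos: "\<And>i. i \<in> I \<Longrightarrow> 0 < d i \<and> d i \<le> D" and D: "D > 0"
    and sep: "\<And>i j. i \<in> I \<Longrightarrow> j \<in> I \<Longrightarrow> i \<noteq> j \<Longrightarrow>
                999/1000 * (d i)\<^sup>2 \<le> sqdist k (a i) (a j) + sqdist k (b i) (b j)"
  shows "(\<Sum>i\<in>I. d i ^ k) \<le> 1000000 * (1 + 2 * D) ^ k / (unit_ball_vol k * (35/100) ^ k * cap_fraction k)"
proof -
  let ?V = "unit_ball_vol k"
  define C where "C = 1000000 * (1 + 2 * D) ^ k / (?V * (35/100) ^ k)"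
  have V: "?V > 0" by simp
  have C: "C \<ge> 0" using D V by (simp add: C_def)
  have cf: "cap_fraction k > 0" by (rule cap_fraction_pos)
  define v where "v i n = (a i n - b i n) / d i" for i n
  have v1: "(\<Sum>n<k. (v i n)\<^sup>2) = 1" if "i \<in> I" for i
  proof -
    have "(\<Sum>n<k. (v i n)\<^sup>2) = (\<Sum>n<k. (a i n - b i n)\<^sup>2) / (d i)\<^sup>2"
      by (simp add: v_def power_divide sum_divide_distrib)
    also have "\<dots> = 1" using dpos[OF that] by (simp add: d_def euclid_dist_power2 sqdist_def[symmetric]) (auto simp: euclid_dist_altdef)
    finally show ?thesis .
  qed
  have capiff: "71/100 \<le> (\<Sum>n<k. \<theta> n * v i n) \<longleftrightarrow> 71/100 * d i \<le> (\<Sum>n<k. \<theta> n * (a i n - b i n))"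
    if "i \<in> I" for i \<theta>
    using dpos[OF that] by (simp add: v_def sum_divide_distrib[symmetric] field_simps)
  let ?U = "ball_in k (\<lambda>_. 0) 1"
  have "ennreal ((\<Sum>i\<in>I. d i ^ k) * (?V * cap_fraction k)) = (\<Sum>i\<in>I. ennreal (d i ^ k) * ennreal (?V * cap_fraction k))"
    using V cf by (simp add: sum_distrib_right sum_ennreal[symmetric] ennreal_mult d_def)
  also have "\<dots> \<le> (\<Sum>i\<in>I. ennreal (d i ^ k) * emeasure (leb k) (cap k (v i)))"
    using emeasure_cap_ge[OF v1] by (intro sum_mono mult_left_mono) auto
  also have "\<dots> = (\<integral>\<^sup>+\<theta>. (\<Sum>i\<in>I. ennreal (d i ^ k) * indicator (cap k (v i)) \<theta>) \<partial>leb k)"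
    by (subst nn_integral_sum) (auto simp: nn_integral_cmult)
  also have "\<dots> \<le> (\<integral>\<^sup>+\<theta>. ennreal C * indicator ?U \<theta> \<partial>leb k)"
  proof (intro nn_integral_mono)
    fix \<theta> assume sp: "\<theta> \<in> space (leb k)"
    show "(\<Sum>i\<in>I. ennreal (d i ^ k) * indicator (cap k (v i)) \<theta>) \<le> ennreal C * indicator ?U \<theta>"
    proof (cases "(\<Sum>n<k. (\<theta> n)\<^sup>2) \<le> 1")
      case True
      have "(\<Sum>i\<in>I. ennreal (d i ^ k) * indicator (cap k (v i)) \<theta>)
        = (\<Sum>i\<in>I. if 71/100 * d i \<le> (\<Sum>n<k. \<theta> n * (a i n - b i n)) then ennreal (d i ^ k) else 0)"
        using True sp capiff by (intro sum.cong) (auto simp: cap_def indicator_def)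
      also have "\<dots> = (\<Sum>i | i \<in> I \<and> 71/100 * d i \<le> (\<Sum>n<k. \<theta> n * (a i n - b i n)). ennreal (d i ^ k))"
        by (rule sum.inter_filter[OF fin, symmetric])
      also have "\<dots> = ennreal (\<Sum>i | i \<in> I \<and> 71/100 * d i \<le> (\<Sum>n<k. \<theta> n * (a i n - b i n)). d i ^ k)"
        by (intro sum_ennreal) (simp add: d_def)
      also have "\<dots> \<le> ennreal C"
        unfolding C_def d_def
        by (intro ennreal_leI short_edges_directed_sum_le[OF fin cube _ D _ True])
           (use dpos sep in \<open>auto simp: d_def\<close>)
      finally show ?thesis using True sp by (simp add: ball_in_def sqdist_def)
    next
      case False
      then have "\<theta> \<notin> cap k (v i)" for i by (simp add: cap_def)
      then show ?thesis by simp
    qed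
  qed
  also have "\<dots> = ennreal (C * ?V)"
    using C V by (simp add: nn_integral_cmult emeasure_ball_in ennreal_mult)
  finally have "(\<Sum>i\<in>I. d i ^ k) * (?V * cap_fraction k) \<le> C * ?V"
    using C V by (subst (asm) ennreal_le_iff) auto
  then have "((\<Sum>i\<in>I. d i ^ k) * cap_fraction k) * ?V \<le> C * ?V" by (simp only: mult_ac)
  then have "(\<Sum>i\<in>I. d i ^ k) * cap_fraction k \<le> C" using V by (simp only: mult_le_cancel_right_pos)
  then have "(\<Sum>i\<in>I. d i ^ k) \<le> C / cap_fraction k" using cf by (simp only: pos_le_divide_eq)
  then show ?thesis by (simp add: C_def)
qed

section \<open>Paths, 2-optimality and merging\<close>

text \<open>The weight is a parameter because the same path is measured by truncated powers, by k-th
  powers and by 0/1 weights that count edges.\<close>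

fun path_sum :: "('a \<Rightarrow> 'a \<Rightarrow> real) \<Rightarrow> 'a list \<Rightarrow> real" where
  "path_sum w (x # y # zs) = w x y + path_sum w (y # zs)"
| "path_sum w _ = 0"

lemma path_sum_append:
  "xs \<noteq> [] \<Longrightarrow> ys \<noteq> [] \<Longrightarrow> path_sum w (xs @ ys) = path_sum w xs + w (last xs) (hd ys) + path_sum w ys"
proof (induction w xs rule: path_sum.induct)
  case ("2_2" w x)
  then show ?case by (cases ys) auto
qed auto

lemma path_sum_rev:
  assumes "\<And>x y. w x y = w y x"
  shows "path_sum w (rev xs) = path_sum w xs"
proof (induction xs)
  case (Cons x xs)
  show ?case
  proof (cases xs)
    case (Cons y ys)
    then have "path_sum w (rev (x # xs)) = path_sum w (rev xs) + w y x"
      using path_sum_append[of "rev xs" "[x]" w] by (simp add: last_rev)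
    then show ?thesis using Cons Cons.IH assms[of x y] by simp
  qed simp
qed simp

lemma path_sum_nth: "path_sum w xs = (\<Sum>i<length xs - 1. w (xs ! i) (xs ! Suc i))"
proof (induction w xs rule: path_sum.induct)
  case (1 w x y zs)
  then show ?case by (simp add: sum.lessThan_Suc_shift del: sum.lessThan_Suc)
qed auto

text \<open>Reversing the stretch of the path between the two edges replaces only these two, joining
  tail to tail and head to head. This pairing, which respects the orientation, is the source of the
  separation condition for the short edges.\<close>

lemma two_opt:
  assumes sym: "\<And>x y. w x y = w y x"
    and min: "\<And>ys. distinct ys \<Longrightarrow> set ys = set xs \<Longrightarrow> path_sum w xs \<le> path_sum w ys"
    and dist: "distinct xs" and i: "i < length xs - 1" and j: "j < length xs - 1" and ij: "i \<noteq> j"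
  shows "w (xs ! i) (xs ! Suc i) + w (xs ! j) (xs ! Suc j) \<le> w (xs ! i) (xs ! j) + w (xs ! Suc i) (xs ! Suc j)"
proof -
  have main: "w (xs ! i) (xs ! Suc i) + w (xs ! j) (xs ! Suc j) \<le> w (xs ! i) (xs ! j) + w (xs ! Suc i) (xs ! Suc j)"
    if i: "i < j" and j: "Suc j < length xs" for i j
  proof -
    define A B C where "A = take (Suc i) xs" and "B = drop (Suc i) (take (Suc j) xs)" and "C = drop (Suc j) xs"
    have xs: "xs = A @ B @ C"
      unfolding A_def B_def C_def using i
      by (metis append.assoc append_take_drop_id less_imp_le_nat min.absorb1 not_less_eq take_take nat_less_le)
    have ne: "A \<noteq> []" "B \<noteq> []" "C \<noteq> []" using i j by (auto simp: A_def B_def C_def)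
    have ends: "last A = xs ! i" "hd B = xs ! Suc i" "last B = xs ! j" "hd C = xs ! Suc j"
      using i j ne by (simp_all add: A_def B_def C_def last_conv_nth hd_drop_conv_nth)
    have "path_sum w xs \<le> path_sum w (A @ rev B @ C)"
      using dist by (intro min) (auto simp: xs)
    moreover have "path_sum w xs = path_sum w A + w (last A) (hd B) + (path_sum w B + w (last B) (hd C) + path_sum w C)"
      using ne by (subst xs) (simp add: path_sum_append)
    moreover have "path_sum w (A @ rev B @ C)
        = path_sum w A + w (last A) (last B) + (path_sum w B + w (hd B) (hd C) + path_sum w C)"
      using ne by (simp add: path_sum_append path_sum_rev[OF sym] hd_rev last_rev)
    ultimately show ?thesis by (simp add: ends)
  qed
  show ?thesis
  proof (cases "i < j")
    case True then show ?thesis using main j by simp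
  next
    case False
    then have "j < i" "Suc i < length xs" using i ij by linarith+
    then show ?thesis using main[of j i] sym[of "xs ! i" "xs ! j"] sym[of "xs ! Suc i" "xs ! Suc j"] by simp
  qed
qed

lemma ex_min_path:
  assumes "finite X"
  obtains xs where "distinct xs" "set xs = X"
    "\<And>ys. distinct ys \<Longrightarrow> set ys = X \<Longrightarrow> path_sum w xs \<le> path_sum w ys"
proof -
  let ?L = "{ys. distinct ys \<and> set ys = X}"
  have "finite ?L"
    by (rule finite_subset[OF _ finite_lists_length_eq[OF assms, of "card X"]])
       (auto simp: distinct_card)
  moreover have "?L \<noteq> {}" using finite_distinct_list[OF assms] by auto
  ultimately obtain m where "m \<in> path_sum w ` ?L" "\<And>z. z \<in> path_sum w ` ?L \<Longrightarrow> \<not> z < m"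
    using ex_min_if_finite[of "path_sum w ` ?L"] by auto
  then show ?thesis using that by (auto simp: not_less)
qed

text \<open>\<open>P\<close> marks the edges to keep: going backwards through the list, a kept edge
  extends the first piece and any other edge opens a new one. Stating total weight and number of
  pieces as path sums turns both into sums over the edge indices of \<open>xs\<close>.\<close>

lemma cut_path:
  fixes w :: "'a \<Rightarrow> 'a \<Rightarrow> real"
  assumes "xs \<noteq> []"
  shows "\<exists>ps. concat ps = xs \<and> [] \<notin> set ps \<and>
     (\<Sum>p\<leftarrow>ps. path_sum w p) = path_sum (\<lambda>x y. if P x y then w x y else 0) xs \<and>
     real (length ps) = 1 + path_sum (\<lambda>x y. if P x y then 0 else 1) xs"
  using assms
proof (induction xs)
  case (Cons x xs)
  show ?case
  proof (cases xs)
    case Nil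
    then show ?thesis by (intro exI[of _ "[[x]]"]) simp
  next
    case (Cons y ys)
    with Cons.IH obtain ps where ps: "concat ps = xs" "[] \<notin> set ps"
      "(\<Sum>p\<leftarrow>ps. path_sum w p) = path_sum (\<lambda>x y. if P x y then w x y else 0) xs"
      "real (length ps) = 1 + path_sum (\<lambda>x y. if P x y then 0 else 1) xs" by auto
    then obtain p qs where pq: "ps = p # qs" using Cons by (cases ps) auto
    then obtain zs where p: "p = y # zs" using ps(1,2) Cons by (cases p) auto
    show ?thesis
    proof (cases "P x y")
      case True
      then show ?thesis using ps pq p Cons by (intro exI[of _ "(x # p) # qs"]) auto
    next
      case False
      then show ?thesis using ps pq p Cons by (intro exI[of _ "[x] # ps"]) auto
    qed
  qed
qed simp

text \<open>The heads are distinct points, one for each path, so \<open>close\<close> finds two that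
  are cheap to join. Reversing one path makes these heads adjacent and leaves one path fewer. The
  merged path has in general another head, which is why \<open>close\<close> is assumed for all
  subsets of \<open>X\<close>.\<close>

lemma merge_paths:
  fixes w :: "'a \<Rightarrow> 'a \<Rightarrow> real"
  assumes sym: "\<And>x y. w x y = w y x"
    and close: "\<And>Y. Y \<subseteq> X \<Longrightarrow> card Y \<ge> 3 \<Longrightarrow> \<exists>x\<in>Y. \<exists>y\<in>Y. x \<noteq> y \<and> w x y \<le> \<Delta> (card Y)"
    and ps: "[] \<notin> set ps" "distinct (concat ps)" "set (concat ps) = X" "length ps \<ge> 2"
  shows "\<exists>p q. p \<noteq> [] \<and> q \<noteq> [] \<and> distinct (p @ q) \<and> set (p @ q) = X \<and>
     path_sum w p + path_sum w q \<le> (\<Sum>p\<leftarrow>ps. path_sum w p) + (\<Sum>j=3..length ps. \<Delta> j)"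
  using ps
proof (induction "length ps" arbitrary: ps rule: less_induct)
  case less
  show ?case
  proof (cases "length ps = 2")
    case True
    then obtain p q where "ps = [p, q]" by (auto simp: length_Suc_conv numeral_2_eq_2)
    then show ?thesis using less.prems by (intro exI[of _ p] exI[of _ q]) auto
  next
    case False
    with less.prems have len: "length ps \<ge> 3" by simp
    have dps: "distinct ps" using less.prems(1,2) by (auto simp: distinct_concat_iff removeAll_id)
    have disj: "set p \<inter> set q = {}" if "p \<in> set ps" "q \<in> set ps" "p \<noteq> q" for p q
      using less.prems(2) that by (auto simp: distinct_concat_iff)
    have hd_in: "hd p \<in> set p" if "p \<in> set ps" for p
      using that less.prems(1) by (metis hd_in_set)
    have inj: "inj_on hd (set ps)"
      using disj hd_in by (fastforce simp: inj_on_def)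
    have card: "card (hd ` set ps) = length ps"
      using inj dps by (simp add: card_image distinct_card)
    have "hd ` set ps \<subseteq> X" using hd_in less.prems(3) by auto
    then obtain x y where xy: "x \<in> hd ` set ps" "y \<in> hd ` set ps" "x \<noteq> y" "w x y \<le> \<Delta> (length ps)"
      using close[of "hd ` set ps"] card len by auto
    then obtain p q where pq: "p \<in> set ps" "q \<in> set ps" "p \<noteq> q" "w (hd p) (hd q) \<le> \<Delta> (length ps)" by auto
    define rs where "rs = remove1 q (remove1 p ps)"
    have ms: "mset ps = add_mset p (add_mset q (mset rs))"
    proof -
      have "p \<in># mset ps" "q \<in># mset ps - {#p#}"
        using pq by (auto simp: in_diff_count)
      from insert_DiffM[OF this(1)] insert_DiffM[OF this(2)] show ?thesis
        unfolding rs_def mset_remove1 by simp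
    qed
    have ne: "p \<noteq> []" "q \<noteq> []" using pq less.prems(1) by auto
    let ?ps = "(rev p @ q) # rs"
    have len': "length ps = Suc (length ?ps)"
      using arg_cong[OF ms, of size] by simp
    have mc: "mset (concat ps) = mset (concat ?ps)"
    proof -
      have "mset (concat ps) = mset p + (mset q + mset (concat rs))"
        using arg_cong[OF ms, of "\<lambda>M. \<Sum>\<^sub># (image_mset mset M)"] by (simp add: mset_concat mset_map[symmetric] sum_mset_sum_list del: mset_map)
      then show ?thesis by simp
    qed
    have sub: "set rs \<subseteq> set ps" unfolding rs_def by (meson order_trans set_remove1_subset)
    have "\<exists>p q. p \<noteq> [] \<and> q \<noteq> [] \<and> distinct (p @ q) \<and> set (p @ q) = X \<and>
      path_sum w p + path_sum w q \<le> (\<Sum>p\<leftarrow>?ps. path_sum w p) + (\<Sum>j=3..length ?ps. \<Delta> j)"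
    proof (rule less.hyps)
      show "length ?ps < length ps" using len' by simp
      show "[] \<notin> set ?ps" using ne sub less.prems(1) by auto
      show "distinct (concat ?ps)" using mc less.prems(2) by (metis mset_eq_imp_distinct_iff)
      show "set (concat ?ps) = X" using mc less.prems(3) by (metis set_mset_mset)
      show "2 \<le> length ?ps" using len' len by simp
    qed
    moreover have "(\<Sum>p\<leftarrow>ps. path_sum w p) = path_sum w p + path_sum w q + (\<Sum>p\<leftarrow>rs. path_sum w p)"
      using arg_cong[OF ms, of "\<lambda>M. \<Sum>\<^sub># (image_mset (path_sum w) M)"] by (simp add: mset_map[symmetric] sum_mset_sum_list del: mset_map)
    moreover have "path_sum w (rev p @ q) = path_sum w p + w (hd p) (hd q) + path_sum w q"
      using ne by (simp add: path_sum_append path_sum_rev[OF sym] last_rev)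
    moreover have "(\<Sum>j=3..length ps. \<Delta> j) = \<Delta> (length ps) + (\<Sum>j=3..length ?ps. \<Delta> j)"
      using len len' by (subst len', subst sum.nat_ivl_Suc') auto
    ultimately show ?thesis using pq(4) by (fastforce intro: order_trans)
  qed
qed

section \<open>Elementary bounds and exchanges for truncated lengths\<close>

lemma euclid_dist_cube_le:
  assumes "x \<in> unit_cube k" "y \<in> unit_cube k"
  shows "euclid_dist k x y \<le> sqrt k"
proof -
  have "sqdist k x y \<le> (\<Sum>i<k. 1)"
    unfolding sqdist_def
  proof (intro sum_mono)
    fix i assume "i \<in> {..<k}"
    then have "\<bar>x i - y i\<bar> \<le> \<bar>1\<bar>" using unit_cubeD[OF assms(1), of i] unit_cubeD[OF assms(2), of i] by auto
    then show "(x i - y i)\<^sup>2 \<le> 1" by (metis abs_le_square_iff one_power2)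
  qed
  then show ?thesis by (simp add: euclid_dist_altdef)
qed

lemma sqrt_power_eq_powr: "k \<ge> 1 \<Longrightarrow> sqrt (real k) ^ k = real k powr (real k / 2)"
  by (simp add: powr_half_sqrt[symmetric] powr_powr powr_realpow[symmetric])

lemma euclid_dist_eq_0_cube:
  assumes "x \<in> unit_cube k" "y \<in> unit_cube k" "euclid_dist k x y = 0"
  shows "x = y"
proof -
  have "(\<Sum>i<k. (x i - y i)\<^sup>2) = 0" using assms(3) by (simp add: euclid_dist_altdef sqdist_def)
  then have "\<forall>i\<in>{..<k}. (x i - y i)\<^sup>2 = 0" by (subst (asm) sum_nonneg_eq_0_iff) auto
  then show ?thesis using assms(1,2) unfolding unit_cube_def by (intro PiE_ext) auto
qed

lemma sum_inverse_le_ln: "m \<ge> 2 \<Longrightarrow> (\<Sum>j=3..m. 1 / real j) \<le> ln m"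
proof (induction m rule: nat_induct_at_least)
  case base
  show ?case by simp
next
  case (Suc m)
  have "ln (real m / real (Suc m)) \<le> real m / real (Suc m) - 1"
    using Suc.hyps by (intro ln_le_minus_one) auto
  also have "\<dots> = - (1 / real (Suc m))" by (simp add: field_simps)
  also have "ln (real m / real (Suc m)) = ln m - ln (Suc m)"
    using Suc.hyps by (simp add: ln_div)
  finally show ?case using Suc by (simp add: sum.nat_ivl_Suc')
qed

text \<open>The large exponent makes the truncated power sum behave like the bottleneck order, so
  that 2-optimality controls the longer of the two exchanged edges almost exactly.\<close>

lemma truncated_two_opt_short:
  assumes N: "2 * (999/1000) ^ N < (1 :: real)"
    and opt: "min (euclid_dist k a b) D ^ (2 * N) + min (euclid_dist k c e) D ^ (2 * N)
      \<le> min (euclid_dist k a c) D ^ (2 * N) + min (euclid_dist k b e) D ^ (2 * N)"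
    and ab: "0 < euclid_dist k a b" "euclid_dist k a b \<le> D"
  shows "999/1000 * (euclid_dist k a b)\<^sup>2 \<le> sqdist k a c + sqdist k b e"
proof (rule ccontr)
  assume neg: "\<not> ?thesis"
  define d where "d = euclid_dist k a b"
  define q :: real where "q = 999/1000"
  have D: "D > 0" using ab by simp
  have small: "min (euclid_dist k u v) D ^ (2 * N) \<le> q ^ N * d ^ (2 * N)"
    if "sqdist k u v \<le> q * d\<^sup>2" for u v
  proof -
    have "min (euclid_dist k u v) D ^ (2 * N) \<le> euclid_dist k u v ^ (2 * N)"
      using D by (intro power_mono) auto
    also have "\<dots> = (sqdist k u v) ^ N"
      by (simp add: euclid_dist_power2[symmetric] power_mult[symmetric])
    also have "\<dots> \<le> (q * d\<^sup>2) ^ N"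
      using that by (intro power_mono) auto
    also have "\<dots> = q ^ N * d ^ (2 * N)"
      unfolding power_mult_distrib by (simp add: power_mult[symmetric])
    finally show ?thesis .
  qed
  have "sqdist k a c \<le> q * d\<^sup>2" "sqdist k b e \<le> q * d\<^sup>2"
    using neg sqdist_nonneg[of k a c] sqdist_nonneg[of k b e] unfolding d_def q_def by linarith+
  note this[THEN small]
  moreover have "(2 * q ^ N) * d ^ (2 * N) < 1 * d ^ (2 * N)"
    using N ab by (intro mult_strict_right_mono) (auto simp: q_def d_def)
  moreover have "min (euclid_dist k a b) D ^ (2 * N) = d ^ (2 * N)" using ab by (simp add: d_def)
  moreover have "0 \<le> min (euclid_dist k c e) D ^ (2 * N)" using D by simp
  ultimately show False using opt by linarith
qed

text \<open>The left side equals 2 * D^N, the largest value the right side can take, so neither of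
  the new edges can be shorter than \<open>D\<close>.\<close>

lemma truncated_two_opt_long:
  assumes opt: "min (euclid_dist k a b) D ^ N + min (euclid_dist k c e) D ^ N
      \<le> min (euclid_dist k a c) D ^ N + min (euclid_dist k b e) D ^ N"
    and D: "D > 0" and N: "N > 0" and long: "D \<le> euclid_dist k a b" "D \<le> euclid_dist k c e"
  shows "D \<le> euclid_dist k b e"
proof (rule ccontr)
  assume "\<not> ?thesis"
  then have "min (euclid_dist k b e) D ^ N < D ^ N"
    using N D by (intro power_strict_mono) auto
  moreover have "min (euclid_dist k a c) D ^ N \<le> D ^ N"
    using D by (intro power_mono) auto
  moreover have "min (euclid_dist k a b) D = D" "min (euclid_dist k c e) D = D" using long by auto
  ultimately show False using opt by simp
qed

text \<open>The bound for the short edges at D = 1 / k. It is an absolute quantity, whereas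
  \<open>long_bound\<close> is measured in units of k powr (k / 2).\<close>

definition short_bound :: "nat \<Rightarrow> real" where
  "short_bound k = 1000000 * (1 + 2 / k) ^ k / (unit_ball_vol k * (35/100) ^ k * cap_fraction k)"

text \<open>The cost factor of a join times a bound for the harmonic sum over the number of paths,
  which is at most 1 + 1500 * k^(2 * k).\<close>

definition long_bound :: "nat \<Rightarrow> real" where
  "long_bound k = 1500 * (169/200) ^ k * ln (1 + 1500 * real k ^ (2 * k))"

lemma ex_two_path_cover:
  assumes fin: "finite X" and X: "X \<subseteq> unit_cube k" and k: "k \<ge> 1" and card: "card X \<ge> 2"
  defines "w \<equiv> \<lambda>x y. euclid_dist k x y ^ k"
  shows "\<exists>p q. p \<noteq> [] \<and> q \<noteq> [] \<and> distinct (p @ q) \<and> set (p @ q) = X \<and>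
     path_sum w p + path_sum w q \<le> short_bound k + real k powr (k / 2) * long_bound k"
proof -
  \<comment> \<open>This choice keeps (1 + 2 * D)^k bounded, while the number of edges of length at
    least D is still only k^O(k), with a logarithm of order k * ln k.\<close>
  define D where "D = 1 / real k"
  have D: "D > 0" using k by (simp add: D_def)
  obtain N where N: "(999/1000 :: real) ^ N < 1/2"
    using real_arch_pow_inv[of "1/2" "999/1000"] by auto
  then have N2: "2 * (999/1000) ^ N < (1::real)" by simp
  have Npos: "0 < 2 * N" using N by (cases N) auto
  define v where "v x y = min (euclid_dist k x y) D ^ (2 * N)" for x y
  obtain xs where xs: "distinct xs" "set xs = X"
    and min: "\<And>ys. distinct ys \<Longrightarrow> set ys = X \<Longrightarrow> path_sum v xs \<le> path_sum v ys"
    using ex_min_path[OF fin] by blast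
  let ?n = "length xs"
  have n: "?n \<ge> 2" using card xs by (metis distinct_card)
  define d where "d i = euclid_dist k (xs ! i) (xs ! Suc i)" for i
  have opt: "v (xs ! i) (xs ! Suc i) + v (xs ! j) (xs ! Suc j) \<le> v (xs ! i) (xs ! j) + v (xs ! Suc i) (xs ! Suc j)"
    if "i < ?n - 1" "j < ?n - 1" "i \<noteq> j" for i j
    by (rule two_opt[where w = v]) (use that xs min in \<open>auto simp: v_def euclid_dist_commute\<close>)
  have cube: "xs ! i \<in> unit_cube k" if "i < ?n" for i
    using that xs X nth_mem by blast
  have dpos: "d i > 0" if "i < ?n - 1" for i
  proof -
    have "xs ! i \<noteq> xs ! Suc i" using that xs(1) by (simp add: nth_eq_iff_index_eq)
    then have "d i \<noteq> 0" using euclid_dist_eq_0_cube[of "xs ! i" k "xs ! Suc i"] cube that by (auto simp: d_def)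
    then show ?thesis by (simp add: d_def less_le)
  qed
  let ?I = "{i \<in> {..<?n - 1}. d i < D}" and ?J = "{i \<in> {..<?n - 1}. \<not> d i < D}"
  have short: "(\<Sum>i\<in>?I. d i ^ k) \<le> short_bound k"
  proof -
    have "(\<Sum>i\<in>?I. euclid_dist k (xs ! i) (xs ! Suc i) ^ k)
       \<le> 1000000 * (1 + 2 * D) ^ k / (unit_ball_vol k * (35/100) ^ k * cap_fraction k)"
    proof (rule short_edges_sum_le)
      fix i assume "i \<in> ?I"
      then show "xs ! i \<in> unit_cube k \<and> xs ! Suc i \<in> unit_cube k"
        "0 < euclid_dist k (xs ! i) (xs ! Suc i) \<and> euclid_dist k (xs ! i) (xs ! Suc i) \<le> D"
        using cube dpos[of i] by (auto simp: d_def)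
    next
      fix i j assume ij: "i \<in> ?I" "j \<in> ?I" "i \<noteq> j"
      show "999/1000 * (euclid_dist k (xs ! i) (xs ! Suc i))\<^sup>2
          \<le> sqdist k (xs ! i) (xs ! j) + sqdist k (xs ! Suc i) (xs ! Suc j)"
        using ij opt[of i j] dpos[of i]
        by (intro truncated_two_opt_short[OF N2, where D = D]) (auto simp: v_def d_def)
    qed (use D in auto)
    then show ?thesis by (simp add: d_def short_bound_def D_def)
  qed
  have cardJ: "real (card ?J) \<le> 1500 * real k ^ (2 * k)"
  proof -
    have inj: "inj_on (\<lambda>i. xs ! Suc i) ?J"
      using xs(1) by (auto simp: inj_on_def nth_eq_iff_index_eq)
    \<comment> \<open>The box side D / k is far from optimal, but the count enters the final bound
      only through its logarithm.\<close>
    have "card ((\<lambda>i. xs ! Suc i) ` ?J) * (D / k) ^ k \<le> 1500"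
    proof (rule separated_cube_card_le)
      show "(\<lambda>i. xs ! Suc i) ` ?J \<subseteq> unit_cube k" using cube by auto
      show "D\<^sup>2 \<le> sqdist k x y"
        if xy: "x \<in> (\<lambda>i. xs ! Suc i) ` ?J" "y \<in> (\<lambda>i. xs ! Suc i) ` ?J" "x \<noteq> y" for x y
      proof -
        obtain i j where ij: "i \<in> ?J" "j \<in> ?J" "x = xs ! Suc i" "y = xs ! Suc j" using xy by blast
        then have "i \<noteq> j" using xy by auto
        then have "v (xs ! i) (xs ! Suc i) + v (xs ! j) (xs ! Suc j) \<le> v (xs ! i) (xs ! j) + v (xs ! Suc i) (xs ! Suc j)"
          using ij by (intro opt) auto
        then have "D \<le> euclid_dist k (xs ! Suc i) (xs ! Suc j)"
          unfolding v_def by (rule truncated_two_opt_long) (use D Npos ij in \<open>simp_all add: d_def\<close>)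
        then have "D\<^sup>2 \<le> (euclid_dist k x y)\<^sup>2"
          unfolding ij using D by (intro power_mono) auto
        then show ?thesis by (simp only: euclid_dist_power2)
      qed
      show "0 < D / k" using D k by simp
      show "D / k \<le> 1" using k mult_mono[of 1 "real k" 1 "real k"] by (simp add: D_def)
      have "real k * (D / k)\<^sup>2 = D\<^sup>2 * (1 / k)" using k by (simp add: power2_eq_square)
      also have "\<dots> \<le> D\<^sup>2 * 1" using k by (intro mult_left_mono) auto
      also have "\<dots> \<le> 142/100 * D\<^sup>2" by simp
      finally show "real k * (D / k)\<^sup>2 \<le> 142/100 * D\<^sup>2" .
    qed (use k D in auto)
    then have "real (card ?J) * (D / k) ^ k \<le> 1500" by (simp only: card_image[OF inj])
    moreover have "(D / k) ^ k = 1 / real k ^ (2 * k)"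
      by (simp add: D_def power_divide power_add mult_2 power_mult_distrib)
    ultimately show ?thesis using k by (simp add: divide_le_eq)
  qed
  have wn: "w x y \<ge> 0" for x y by (simp add: w_def)
  have ne: "xs \<noteq> []" using n by auto
  obtain ps where ps: "concat ps = xs" "[] \<notin> set ps"
    "(\<Sum>p\<leftarrow>ps. path_sum w p) = path_sum (\<lambda>x y. if euclid_dist k x y < D then w x y else 0) xs"
    "real (length ps) = 1 + path_sum (\<lambda>x y. if euclid_dist k x y < D then 0 else 1) xs"
    using cut_path[OF ne, of w "\<lambda>x y. euclid_dist k x y < D"] by blast
  have sum_ps: "(\<Sum>p\<leftarrow>ps. path_sum w p) \<le> short_bound k"
  proof -
    have "(\<Sum>p\<leftarrow>ps. path_sum w p) = (\<Sum>i\<in>?I. d i ^ k)"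
      unfolding ps(3) unfolding path_sum_nth by (subst sum.inter_filter) (auto simp: d_def w_def intro!: sum.cong)
    then show ?thesis using short by simp
  qed
  have len: "real (length ps) = 1 + real (card ?J)"
  proof -
    have "path_sum (\<lambda>x y. if euclid_dist k x y < D then 0 else 1) xs = (\<Sum>i<?n - 1. if \<not> d i < D then 1 else 0)"
      unfolding path_sum_nth by (intro sum.cong) (auto simp: d_def)
    also have "\<dots> = real (card ?J)" by (subst sum.inter_filter[symmetric]) auto
    finally show ?thesis using ps(4) by simp
  qed
  have lb: "long_bound k \<ge> 0" by (simp add: long_bound_def)
  show ?thesis
  proof (cases "length ps \<ge> 2")
    case True
    let ?\<Delta> = "\<lambda>j. real k powr (k / 2) * (1500 * (169/200) ^ k / real j)"
    have ex: "\<exists>p q. p \<noteq> [] \<and> q \<noteq> [] \<and> distinct (p @ q) \<and> set (p @ q) = X \<and>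
        path_sum w p + path_sum w q \<le> (\<Sum>p\<leftarrow>ps. path_sum w p) + (\<Sum>j=3..length ps. ?\<Delta> j)"
    proof (rule merge_paths)
      fix Y assume "Y \<subseteq> X" "3 \<le> card Y"
      then show "\<exists>x\<in>Y. \<exists>y\<in>Y. x \<noteq> y \<and> w x y \<le> ?\<Delta> (card Y)"
        unfolding w_def using X k by (intro closest_pair_cube) auto
    qed (use ps xs True in \<open>auto simp: w_def euclid_dist_commute\<close>)
    have joins: "(\<Sum>j=3..length ps. ?\<Delta> j) \<le> real k powr (k / 2) * long_bound k"
    proof -
      have "(\<Sum>j=3..length ps. ?\<Delta> j) = real k powr (k / 2) * (1500 * (169/200) ^ k * (\<Sum>j=3..length ps. 1 / real j))"
        by (simp add: sum_distrib_left)
      also have "\<dots> \<le> real k powr (k / 2) * (1500 * (169/200) ^ k * ln (1 + 1500 * real k ^ (2 * k)))"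
      proof (intro mult_left_mono)
        have "(\<Sum>j=3..length ps. 1 / real j) \<le> ln (length ps)" by (rule sum_inverse_le_ln[OF True])
        also have "\<dots> \<le> ln (1 + 1500 * real k ^ (2 * k))"
          using len cardJ True by (subst ln_le_cancel_iff) (auto intro: add_pos_nonneg)
        finally show "(\<Sum>j=3..length ps. 1 / real j) \<le> ln (1 + 1500 * real k ^ (2 * k))" .
      qed auto
      finally show ?thesis by (simp add: long_bound_def)
    qed
    obtain p q where pq: "p \<noteq> []" "q \<noteq> []" "distinct (p @ q)" "set (p @ q) = X"
      "path_sum w p + path_sum w q \<le> (\<Sum>p\<leftarrow>ps. path_sum w p) + (\<Sum>j=3..length ps. ?\<Delta> j)"
      using ex by blast
    have "path_sum w p + path_sum w q \<le> short_bound k + real k powr (k / 2) * long_bound k"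
      using pq(5) sum_ps joins by linarith
    with pq(1-4) show ?thesis by blast
  next
    case False
    \<comment> \<open>Nothing was cut, so the single path is split after its first vertex; losing
      that edge can only lower the sum.\<close>
    have "length ps = 1" using False len by linarith
    then have psx: "ps = [xs]" using ps(1) by (cases ps) auto
    obtain x y zs where xyz: "xs = x # y # zs" using n by (cases xs; cases "tl xs") auto
    have "path_sum w [x] + path_sum w (y # zs) \<le> path_sum w xs" using wn[of x y] by (simp add: xyz)
    also have "\<dots> \<le> short_bound k" using sum_ps psx by simp
    also have "\<dots> \<le> short_bound k + real k powr (k / 2) * long_bound k" using lb by simp
    finally show ?thesis using xs by (intro exI[of _ "[x]"] exI[of _ "y # zs"]) (auto simp: xyz)
  qed
qed

section \<open>Asymptotics and the tour\<close>

lemma unit_ball_vol_add_2: "unit_ball_vol (real (k + 2)) = 2 * pi / (real k + 2) * unit_ball_vol k"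
proof -
  let ?h = "real k / 2"
  have G: "Gamma (?h + 1 + 1) = (?h + 1) * Gamma (?h + 1)"
    by (rule Gamma_plus1) (simp add: nonpos_Ints_def)
  have "unit_ball_vol (real (k + 2)) = pi powr (?h + 1) / Gamma (?h + 1 + 1)"
    by (simp add: unit_ball_vol_def add_divide_distrib add.commute)
  also have "\<dots> = pi / (?h + 1) * (pi powr ?h / Gamma (?h + 1))"
    unfolding G by (simp add: powr_add)
  also have "pi / (?h + 1) = 2 * pi / (real k + 2)" by (simp add: field_simps)
  finally show ?thesis by (simp add: unit_ball_vol_def)
qed

text \<open>17 is just below 2 * pi * e, and ((k + 2) / k)^(k / 2 + 1) is at least e because ln x
  \<ge> 1 - 1 / x.\<close>

lemma ball_vol_growth_step:
  assumes "k \<ge> 1"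
  shows "17 * real k \<le> 2 * pi * ((real k + 2) * ((real k + 2) / real k) powr (real k / 2))"
proof -
  define x where "x = (real k + 2) / real k"
  have k: "real k > 0" using assms by simp
  have x: "x > 0" using k by (simp add: x_def)
  have "ln (1 / x) \<le> 1 / x - 1" using x by (intro ln_le_minus_one) auto
  then have "1 - 1 / x \<le> ln x" using x by (simp add: ln_div)
  moreover have "1 - 1 / x = 2 / (real k + 2)" using k by (simp add: x_def field_simps)
  ultimately have "(real k / 2 + 1) * (2 / (real k + 2)) \<le> (real k / 2 + 1) * ln x"
    using k by (intro mult_left_mono) auto
  moreover have "(real k / 2 + 1) * (2 / (real k + 2)) = 1" using k by (simp add: field_simps)
  ultimately have "exp 1 \<le> exp ((real k / 2 + 1) * ln x)" by simp
  also have "\<dots> = x powr (real k / 2) * x" using x by (simp add: powr_def exp_add ring_distribs)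
  finally have e: "exp 1 \<le> x powr (real k / 2) * x" .
  have e1: "271/100 \<le> exp (1 :: real)" using e_approx_32 unfolding abs_le_iff by simp
  have "(17::real) \<le> 2 * (314/100 * (271/100))" by simp
  also have "\<dots> \<le> 2 * (pi * exp 1)"
    using pi_approx e1 by (intro mult_left_mono mult_mono) auto
  also have "\<dots> \<le> 2 * (pi * (x powr (real k / 2) * x))" using e by (intro mult_left_mono) auto
  finally have "17 * real k \<le> 2 * (pi * (x powr (real k / 2) * x)) * real k"
    using k by (intro mult_right_mono) auto
  also have "\<dots> = 2 * pi * ((x * real k) * x powr (real k / 2))" by (simp only: mult_ac)
  also have "x * real k = real k + 2" using k by (simp add: x_def)
  finally show ?thesis by (simp add: x_def)
qed

text \<open>A weak form of Stirling's formula, by which the volume is (2 * pi * e / k)^(k / 2) up to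
  a polynomial factor. The induction advances by two dimensions. The extra factor
  \<open>real k\<close> raises the exponent of (m + 2) / m from m / 2 to m / 2 + 1, where e is a
  lower bound. The divisor 5 settles the base cases, at k = 1 through sqrt 17 \<le> 5.\<close>

lemma unit_ball_vol_ge:
  "k \<ge> 1 \<Longrightarrow> 17 powr (real k / 2) / 5 \<le> unit_ball_vol k * real k powr (real k / 2) * real k"
proof (induction k rule: less_induct)
  case (less k)
  consider "k = 1" | "k = 2" | "k \<ge> 3" using less.prems by linarith
  then show ?case
  proof cases
    case 1
    have "sqrt 17 \<le> sqrt 25" by (subst real_sqrt_le_iff) simp
    then have "sqrt 17 \<le> 5" by simp
    then show ?thesis using 1 by (simp add: powr_half_sqrt)
  next
    case 2
    then show ?thesis using pi_gt3 by (simp add: unit_ball_vol_2)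
  next
    case 3
    define m where "m = k - 2"
    have m: "m \<ge> 1" "k = m + 2" "m < k" using 3 by (auto simp: m_def)
    let ?r = "(real m + 2) / real m"
    have mp: "real m > 0" using m by simp
    have km: "real k / 2 = real m / 2 + 1" "real k = real m + 2" using m(2) by simp_all
    have pw: "(real m + 2) powr (real m / 2) = real m powr (real m / 2) * ?r powr (real m / 2)"
      using mp by (simp add: powr_mult[symmetric])
    have "17 powr (real k / 2) / 5 = 17 * (17 powr (real m / 2) / 5)"
      by (simp only: km(1) powr_add) simp
    also have "\<dots> \<le> 17 * (unit_ball_vol m * real m powr (real m / 2) * real m)"
      using less.IH[OF m(3,1)] by (intro mult_left_mono) auto
    also have "\<dots> = (unit_ball_vol m * real m powr (real m / 2)) * (17 * real m)" by (simp only: mult_ac)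
    also have "\<dots> \<le> (unit_ball_vol m * real m powr (real m / 2)) * (2 * pi * ((real m + 2) * ?r powr (real m / 2)))"
      by (intro mult_left_mono ball_vol_growth_step m) auto
    also have "\<dots> = (2 * pi * unit_ball_vol m) * ((real m powr (real m / 2) * ?r powr (real m / 2)) * (real m + 2))"
      by (simp only: mult_ac)
    also have "\<dots> = (2 * pi * unit_ball_vol m) * ((real m + 2) powr (real m / 2) * (real m + 2))"
      by (simp only: pw)
    also have "\<dots> = (2 * pi / (real m + 2) * unit_ball_vol m) * ((real m + 2) powr (real m / 2) * (real m + 2)) * (real m + 2)"
      using mp by (simp add: field_simps)
    also have "2 * pi / (real m + 2) * unit_ball_vol m = unit_ball_vol k"
      unfolding m(2) unit_ball_vol_add_2 ..
    also have "(real m + 2) powr (real m / 2) * (real m + 2) = real k powr (real k / 2)"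
      unfolding km(1) powr_add using mp by (simp add: km(2))
    also have "real m + 2 = real k" by (simp add: km)
    finally show ?thesis .
  qed
qed

text \<open>The subtracted term decays at the rate sqrt 0.489999 < 0.7, so it is eventually at most
  half of (7/10)^k.\<close>

lemma cap_fraction_ge: "eventually (\<lambda>k. (7/10) ^ k / 2 \<le> cap_fraction k) sequentially"
proof -
  define q where "q = sqrt (489999/1000000) / (7/10)"
  have "sqrt (489999/1000000) < sqrt ((7/10)\<^sup>2)" by (subst real_sqrt_less_iff) (simp add: power2_eq_square)
  then have "0 \<le> q" "q < 1" by (auto simp: q_def)
  have "(\<lambda>k. q ^ k) \<longlonglongrightarrow> 0" using \<open>0 \<le> q\<close> \<open>q < 1\<close> by (intro LIMSEQ_realpow_zero) auto
  then have "eventually (\<lambda>k. q ^ k < 1/4) sequentially"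
    by (rule order_tendstoD) simp
  then show ?thesis
  proof eventually_elim
    case (elim k)
    have "sqrt (489999/1000000) ^ k = q ^ k * (7/10) ^ k"
      by (simp add: q_def power_mult_distrib[symmetric])
    also have "\<dots> \<le> 1/4 * (7/10) ^ k" using elim by (intro mult_right_mono) auto
    finally show ?case by (simp add: cap_fraction_def le_max_iff_disj)
  qed
qed

section \<open>The error term and its limit\<close>

definition tour_error :: "nat \<Rightarrow> real" where
  "tour_error k = short_bound k / real k powr (real k / 2) + long_bound k"

lemma short_bound_nonneg: "0 \<le> short_bound k"
  using cap_fraction_pos[of k] by (simp add: short_bound_def)

lemma tour_error_nonneg: "0 \<le> tour_error k"
  using short_bound_nonneg[of k] by (simp add: tour_error_def long_bound_def)

lemma long_bound_tendsto: "long_bound \<longlonglongrightarrow> 0"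
proof (rule tendsto_sandwich)
  show "eventually (\<lambda>k. 0 \<le> long_bound k) sequentially" by (simp add: long_bound_def)
  show "eventually (\<lambda>k. long_bound k \<le> 1500 * (169/200) ^ k * (ln 1501 + 2 * real k * ln (real k))) sequentially"
    using eventually_ge_at_top[of 1]
  proof eventually_elim
    case (elim k)
    have "1 + 1500 * real k ^ (2 * k) \<le> 1501 * real k ^ (2 * k)" using elim by simp
    then have "ln (1 + 1500 * real k ^ (2 * k)) \<le> ln (1501 * real k ^ (2 * k))"
      using elim by (subst ln_le_cancel_iff) (auto intro: add_pos_nonneg)
    also have "\<dots> = ln 1501 + 2 * real k * ln (real k)"
      using elim by (simp add: ln_mult ln_realpow)
    finally show ?case by (simp add: long_bound_def)
  qed
  show "(\<lambda>k. 1500 * (169/200) ^ k * (ln 1501 + 2 * real k * ln (real k))) \<longlonglongrightarrow> 0"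
    by real_asymp
qed auto

lemma short_bound_tendsto: "(\<lambda>k. short_bound k / real k powr (real k / 2)) \<longlonglongrightarrow> 0"
proof (rule tendsto_sandwich)
  let ?C = "10000000 * exp 2 :: real"
  show "eventually (\<lambda>k. 0 \<le> short_bound k / real k powr (real k / 2)) sequentially"
    using short_bound_nonneg by simp
  show "eventually (\<lambda>k. short_bound k / real k powr (real k / 2) \<le> ?C * real k / (1009/1000) ^ k) sequentially"
    using cap_fraction_ge eventually_ge_at_top[of 1]
  proof eventually_elim
    case (elim k)
    then have k: "k \<ge> 1" "real k > 0" by auto
    let ?V = "unit_ball_vol k" and ?P = "real k powr (real k / 2)"
    have "(1 + 2 / real k) ^ k \<le> exp (2 / real k) ^ k"
      using exp_ge_add_one_self[of "2 / real k"] by (intro power_mono) auto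
    also have "\<dots> = exp 2" using k by (simp add: exp_of_nat_mult[symmetric])
    finally have num: "1000000 * (1 + 2 / real k) ^ k \<le> 1000000 * exp 2" by simp
    have "sqrt ((412/100)\<^sup>2) \<le> sqrt 17" by (subst real_sqrt_le_iff) (simp add: power2_eq_square)
    then have s17: "412/100 \<le> sqrt 17" by simp
    \<comment> \<open>The decisive numbers: 4.12 * 0.35 * 0.7 = 1.0094 exceeds 1, so the bound
      decays exponentially and beats the factor of order k.\<close>
    have "(1009/1000 :: real) ^ k \<le> (412/100 * (35/100) * (7/10)) ^ k" by (intro power_mono) auto
    also have "\<dots> \<le> (sqrt 17 * (35/100) * (7/10)) ^ k" using s17 by (intro power_mono mult_right_mono) auto
    also have "\<dots> = 17 powr (real k / 2) * (35/100) ^ k * (7/10) ^ k"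
      unfolding power_mult_distrib by (simp add: powr_half_sqrt[symmetric] powr_powr powr_realpow[symmetric])
    finally have "(1009/1000 :: real) ^ k \<le> 17 powr (real k / 2) * (35/100) ^ k * (7/10) ^ k" .
    also have "\<dots> \<le> (5 * (?V * ?P * real k)) * (35/100) ^ k * (2 * cap_fraction k)"
      using unit_ball_vol_ge[OF k(1)] elim(1) by (intro mult_mono) auto
    also have "\<dots> = 10 * real k * (?V * (35/100) ^ k * cap_fraction k * ?P)" by simp
    finally have den: "(1009/1000) ^ k / (10 * real k) \<le> ?V * (35/100) ^ k * cap_fraction k * ?P"
      using k by (simp add: divide_le_eq mult.commute)
    have "short_bound k / ?P = 1000000 * (1 + 2 / real k) ^ k / (?V * (35/100) ^ k * cap_fraction k * ?P)"
      by (simp add: short_bound_def)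
    also have "\<dots> \<le> (1000000 * exp 2) / ((1009/1000) ^ k / (10 * real k))"
      using k by (intro frac_le num den) auto
    also have "\<dots> = ?C * real k / (1009/1000) ^ k" by simp
    finally show ?case .
  qed
  show "(\<lambda>k. ?C * real k / (1009/1000) ^ k) \<longlonglongrightarrow> 0"
    by real_asymp
qed auto

section \<open>Closing the two paths to a tour\<close>

lemma sum_without_two_largest_le:
  fixes f :: "'a \<Rightarrow> real"
  assumes fin: "finite A" and e: "e1 \<in> A" "e2 \<in> A" "e1 \<noteq> e2" and g: "g1 \<in> A" "g2 \<in> A" "g1 \<noteq> g2"
    and max: "\<And>x. x \<in> A - {e1, e2} \<Longrightarrow> f x \<le> f e1 \<and> f x \<le> f e2"
  shows "sum f (A - {e1, e2}) \<le> sum f (A - {g1, g2})"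
proof -
  have "sum f (A - {x, y}) = sum f A - f x - f y" if "x \<in> A" "y \<in> A" "x \<noteq> y" for x y
    using that fin by (simp add: sum_diff)
  moreover have "f g1 + f g2 \<le> f e1 + f e2"
    using max[of g1] max[of g2] g by (cases "g1 \<in> {e1, e2}"; cases "g2 \<in> {e1, e2}") auto
  ultimately show ?thesis using e g by simp
qed

text \<open>Edge \<open>length p - 1\<close> runs from the end of \<open>p\<close> to the start of
  \<open>q\<close>, and edge \<open>length xs - 1\<close> closes the cycle, where the modulus wraps
  around; all others lie inside one of the paths.\<close>

lemma sum_cycle_without_joins:
  fixes w :: "point \<Rightarrow> point \<Rightarrow> real"
  assumes p: "p \<noteq> []" and q: "q \<noteq> []"
  defines "xs \<equiv> p @ q"
  shows "(\<Sum>i\<in>{..<length xs} - {length p - 1, length xs - 1}. w (xs ! i) (xs ! (Suc i mod length xs)))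
     = path_sum w p + path_sum w q"
proof -
  let ?n = "length xs" and ?g = "length p - 1"
  have n: "?g < ?n - 1" using p q by (cases p; cases q) (auto simp: xs_def)
  have set: "{..<?n} - {?g, ?n - 1} = {..<?n - 1} - {?g}" using n by auto
  have "(\<Sum>i\<in>{..<?n} - {?g, ?n - 1}. w (xs ! i) (xs ! (Suc i mod ?n))) = (\<Sum>i\<in>{..<?n - 1} - {?g}. w (xs ! i) (xs ! Suc i))"
    unfolding set by (intro sum.cong refl) auto
  also have "\<dots> = path_sum w xs - w (xs ! ?g) (xs ! Suc ?g)"
    using n by (simp add: path_sum_nth sum_diff)
  also have "xs ! ?g = last p"
    using p by (simp add: xs_def nth_append last_conv_nth)
  also have "xs ! Suc ?g = hd q"
    using p q by (simp add: xs_def nth_append hd_conv_nth)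
  finally show ?thesis using p q by (simp add: xs_def path_sum_append)
qed

lemma ex_short_tour:
  assumes fin: "finite X" and ne: "X \<noteq> {}" and X: "X \<subseteq> unit_cube k" and k: "k \<ge> 1"
  shows "\<exists>xs. hamiltonian_cycle X xs \<and>
            (\<forall>e1 e2. two_longest_edges k xs e1 e2 \<longrightarrow>
               (\<Sum>e \<in> {..<length xs} - {e1, e2}. edge_length k xs e ^ k)
                 \<le> tour_error k * real k powr (real k / 2)) \<and>
            cycle_sum k k xs \<le> real k powr (real k / 2) * (2 + tour_error k)"
proof (cases "card X = 1")
  case True
  then obtain x where x: "X = {x}" by (rule card_1_singletonE)
  have "hamiltonian_cycle X [x]" by (simp add: hamiltonian_cycle_def x)
  moreover have "{..<length [x]} - {e1, e2} = {}" if "two_longest_edges k [x] e1 e2" for e1 e2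
    using that by (auto simp: two_longest_edges_def)
  then have "(\<Sum>e \<in> {..<length [x]} - {e1, e2}. edge_length k [x] e ^ k) \<le> tour_error k * real k powr (real k / 2)"
    if "two_longest_edges k [x] e1 e2" for e1 e2
    using that tour_error_nonneg[of k] by (simp only: sum.empty) simp
  \<comment> \<open>Here k \<ge> 1 matters: the degenerate edge contributes 0 ^ k = 0.\<close>
  moreover have "cycle_sum k k [x] = 0"
    using k by (simp add: cycle_sum_def edge_length_def euclid_dist_altdef sqdist_def)
  then have "cycle_sum k k [x] \<le> real k powr (real k / 2) * (2 + tour_error k)"
    using tour_error_nonneg[of k] by simp
  ultimately show ?thesis by blast
next
  case False
  then have card: "card X \<ge> 2" using fin ne by (cases "card X") auto
  let ?P = "real k powr (real k / 2)" and ?w = "\<lambda>x y. euclid_dist k x y ^ k"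
  have P: "?P > 0" using k by simp
  obtain p q where pq: "p \<noteq> []" "q \<noteq> []" "distinct (p @ q)" "set (p @ q) = X"
    and le: "path_sum ?w p + path_sum ?w q \<le> short_bound k + ?P * long_bound k"
    using ex_two_path_cover[OF fin X k card] by blast
  define xs where "xs = p @ q"
  let ?n = "length xs" and ?g = "length p - 1" and ?h = "length xs - 1"
  have g: "?g \<in> {..<?n}" "?h \<in> {..<?n}" "?g \<noteq> ?h" using pq(1,2) by (cases p; cases q; simp add: xs_def)+
  have n: "?n \<ge> 2" using pq(1,2) by (cases p; cases q) (auto simp: xs_def)
  have rest: "(\<Sum>e\<in>{..<?n} - {?g, ?h}. edge_length k xs e ^ k) \<le> tour_error k * ?P"
  proof -
    have "(\<Sum>e\<in>{..<?n} - {?g, ?h}. edge_length k xs e ^ k) = path_sum ?w p + path_sum ?w q"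
      using sum_cycle_without_joins[OF pq(1,2), of ?w] by (simp add: xs_def edge_length_def)
    also have "\<dots> \<le> short_bound k + ?P * long_bound k" by (rule le)
    also have "\<dots> = tour_error k * ?P" using P by (simp add: tour_error_def distrib_right)
    finally show ?thesis .
  qed
  have nonneg: "0 \<le> edge_length k xs e" for e by (simp add: edge_length_def)
  have edge: "edge_length k xs e ^ k \<le> ?P" if "e < ?n" for e
  proof -
    have "Suc e mod ?n < ?n" using n by (intro mod_less_divisor) linarith
    then have "xs ! e \<in> X" "xs ! (Suc e mod ?n) \<in> X"
      using that n unfolding pq(4)[symmetric] xs_def[symmetric] by (auto intro: nth_mem)
    then have "edge_length k xs e \<le> sqrt k"
      unfolding edge_length_def using X by (intro euclid_dist_cube_le) auto
    then show ?thesis using nonneg[of e] unfolding sqrt_power_eq_powr[OF k, symmetric]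
      by (intro power_mono)
  qed
  have "hamiltonian_cycle X xs" using pq by (simp add: hamiltonian_cycle_def xs_def)
  moreover have "(\<Sum>e\<in>{..<?n} - {e1, e2}. edge_length k xs e ^ k) \<le> tour_error k * ?P"
    if "two_longest_edges k xs e1 e2" for e1 e2
  proof -
    \<comment> \<open>The two joining edges may differ from the two longest, but taking out the two
      longest leaves the smallest remainder.\<close>
    have "(\<Sum>e\<in>{..<?n} - {e1, e2}. edge_length k xs e ^ k) \<le> (\<Sum>e\<in>{..<?n} - {?g, ?h}. edge_length k xs e ^ k)"
    proof (rule sum_without_two_largest_le)
      fix x assume "x \<in> {..<?n} - {e1, e2}"
      then show "edge_length k xs x ^ k \<le> edge_length k xs e1 ^ k \<and> edge_length k xs x ^ k \<le> edge_length k xs e2 ^ k"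
        using that nonneg by (auto simp: two_longest_edges_def intro!: power_mono)
    qed (use that n g in \<open>auto simp: two_longest_edges_def\<close>)
    then show ?thesis using rest by linarith
  qed
  moreover have "cycle_sum k k xs \<le> ?P * (2 + tour_error k)"
  proof -
    have "cycle_sum k k xs = (\<Sum>e\<in>{..<?n} - {?g, ?h}. edge_length k xs e ^ k)
        + edge_length k xs ?g ^ k + edge_length k xs ?h ^ k"
      unfolding cycle_sum_def using g by (simp add: sum_diff)
    then show ?thesis using rest edge[of ?g] edge[of ?h] g by (simp add: algebra_simps)
  qed
  ultimately show ?thesis by blast
qed

section \<open>The supremum over all finite sets\<close>

lemma finite_hamiltonian_cycles: "finite X \<Longrightarrow> finite {xs. hamiltonian_cycle X xs}"
  by (rule finite_subset[OF _ finite_lists_length_eq[of X "card X"]])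
     (auto simp: hamiltonian_cycle_def distinct_card)

lemma sup_min_cycle_sum_le:
  assumes k: "k \<ge> 1"
  shows "sup_min_cycle_sum k \<le> ereal (real k powr (real k / 2) * (2 + tour_error k))"
  unfolding sup_min_cycle_sum_def
proof (intro SUP_least)
  fix X assume "X \<in> {X. finite X \<and> X \<noteq> {} \<and> X \<subseteq> unit_cube k}"
  then have X: "finite X" "X \<noteq> {}" "X \<subseteq> unit_cube k" by auto
  from ex_short_tour[OF this k] obtain xs where xs: "hamiltonian_cycle X xs"
    "cycle_sum k k xs \<le> real k powr (real k / 2) * (2 + tour_error k)" by blast
  have "min_cycle_sum k X \<le> cycle_sum k k xs"
    unfolding min_cycle_sum_def using xs(1) finite_hamiltonian_cycles[OF X(1)] by (intro Min_le) auto
  with xs(2) show "ereal (min_cycle_sum k X) \<le> ereal (real k powr (real k / 2) * (2 + tour_error k))"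
    by simp
qed

text \<open>Two opposite vertices of the cube already force two edges of length \<open>sqrt k\<close>.\<close>

lemma sup_min_cycle_sum_ge:
  assumes k: "k \<ge> 1"
  shows "ereal (2 * real k powr (real k / 2)) \<le> sup_min_cycle_sum k"
proof -
  define a b :: point where "a = restrict (\<lambda>_. 0) {..<k}" and "b = restrict (\<lambda>_. 1) {..<k}"
  have ab: "a \<in> unit_cube k" "b \<in> unit_cube k" by (auto simp: a_def b_def unit_cube_def)
  have "a 0 \<noteq> b 0" using k by (simp add: a_def b_def)
  then have neq: "a \<noteq> b" by auto
  have dist: "euclid_dist k a b = sqrt k" "euclid_dist k b a = sqrt k"
    by (simp_all add: euclid_dist_altdef sqdist_def a_def b_def)
  have two: "cycle_sum k k xs = 2 * real k powr (real k / 2)" if "hamiltonian_cycle {a, b} xs" for xs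
  proof -
    have xs: "distinct xs" "set xs = {a, b}" using that by (auto simp: hamiltonian_cycle_def)
    then have "length xs = 2" using neq distinct_card[of xs] by simp
    then obtain x y where "xs = [x, y]" by (auto simp: length_Suc_conv numeral_2_eq_2)
    with xs neq have "xs = [a, b] \<or> xs = [b, a]" by (auto simp: doubleton_eq_iff)
    then show ?thesis
      by (auto simp: cycle_sum_def edge_length_def dist numeral_2_eq_2 sqrt_power_eq_powr[OF k])
  qed
  have "hamiltonian_cycle {a, b} [a, b]" using neq by (simp add: hamiltonian_cycle_def)
  then have "cycle_sum k k ` {xs. hamiltonian_cycle {a, b} xs} = {2 * real k powr (real k / 2)}"
    using two by force
  then have "min_cycle_sum k {a, b} = 2 * real k powr (real k / 2)" by (simp add: min_cycle_sum_def)
  moreover have "ereal (min_cycle_sum k {a, b}) \<le> sup_min_cycle_sum k"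
    unfolding sup_min_cycle_sum_def using ab by (intro SUP_upper) auto
  ultimately show ?thesis by simp
qed

lemma tour_error_tendsto: "tour_error \<longlonglongrightarrow> 0"
proof -
  have "(\<lambda>k. short_bound k / real k powr (real k / 2) + long_bound k) \<longlonglongrightarrow> 0 + 0"
    by (intro tendsto_add short_bound_tendsto long_bound_tendsto)
  then show ?thesis by (simp add: tour_error_def[abs_def])
qed

lemma sup_min_cycle_sum_tendsto:
  "(\<lambda>k. sup_min_cycle_sum k / ereal (real k powr (real k / 2))) \<longlonglongrightarrow> 2"
proof (rule tendsto_sandwich)
  let ?P = "\<lambda>k. real k powr (real k / 2)"
  show "eventually (\<lambda>k. 2 \<le> sup_min_cycle_sum k / ereal (?P k)) sequentially"
    using eventually_ge_at_top[of 1]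
  proof eventually_elim
    case (elim k)
    then have P: "?P k > 0" by simp
    have "ereal (2 * ?P k) / ereal (?P k) \<le> sup_min_cycle_sum k / ereal (?P k)"
      using P by (intro ereal_divide_right_mono sup_min_cycle_sum_ge elim) auto
    then show ?case using P by simp
  qed
  show "eventually (\<lambda>k. sup_min_cycle_sum k / ereal (?P k) \<le> ereal (2 + tour_error k)) sequentially"
    using eventually_ge_at_top[of 1]
  proof eventually_elim
    case (elim k)
    then have P: "?P k > 0" by simp
    have "sup_min_cycle_sum k / ereal (?P k) \<le> ereal (?P k * (2 + tour_error k)) / ereal (?P k)"
      using P by (intro ereal_divide_right_mono sup_min_cycle_sum_le elim) auto
    then show ?case using P by simp
  qed
  have "(\<lambda>k. 2 + tour_error k) \<longlonglongrightarrow> 2 + 0"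
    by (intro tendsto_intros tour_error_tendsto)
  then have "(\<lambda>k. ereal (2 + tour_error k)) \<longlonglongrightarrow> ereal 2" by simp
  then show "(\<lambda>k. ereal (2 + tour_error k)) \<longlonglongrightarrow> 2" by simp
qed auto

theorem theorem1p7:
  "(\<exists>\<epsilon> :: nat \<Rightarrow> real.
      (\<forall>k\<ge>1. 0 \<le> \<epsilon> k) \<and> \<epsilon> \<longlonglongrightarrow> 0 \<and>
      (\<forall>k\<ge>1. \<forall>X. finite X \<and> X \<noteq> {} \<and> X \<subseteq> unit_cube k \<longrightarrow>
         (\<exists>xs. hamiltonian_cycle X xs \<and>
            (\<forall>e1 e2. two_longest_edges k xs e1 e2 \<longrightarrow>
               (\<Sum>e \<in> {..<length xs} - {e1, e2}. edge_length k xs e ^ k)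
                 \<le> \<epsilon> k * real k powr (real k / 2)) \<and>
            cycle_sum k k xs \<le> real k powr (real k / 2) * (2 + \<epsilon> k))))
   \<and> (\<lambda>k. sup_min_cycle_sum k / ereal (real k powr (real k / 2))) \<longlonglongrightarrow> 2"
  using tour_error_nonneg tour_error_tendsto ex_short_tour sup_min_cycle_sum_tendsto
  by (intro conjI exI[of _ tour_error] allI impI) auto

end
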